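(* Let $G$ be a finite group and $p$ a prime dividing $|G|$. Assume that for any two distinct Sylow $p$-subgroups $P$ and $Q$ of $G$, the inequality $|P\cap Q|\le |Z_{p-1}(P)|$ is satisfied. Then, for a Sylow $p$-subgroup $P$ of $G$, $N_G(P)$ controls $p$-transfer in $G$.
   Context: All groups are finite. $Z_k(P)$ denotes the $k$-th term of the upper central series of $P$ ($Z_0(P)=1$, $Z_1(P)=Z(P)$, $Z_{k+1}(P)/Z_k(P)=Z(P/Z_k(P))$). $A^p(G)$ denotes the smallest normal subgroup of $G$ whose quotient is an abelian $p$-group. If $N\le G$ has index coprime to $p$, then $N$ controls $p$-transfer in $G$ if $N/A^p(N)\cong G/A^p(G)$. *)

theory Defs
  imports "HOL-Algebra.Algebra"
begin

definition p_group :: "nat \<Rightarrow> ('a, 'b) monoid_scheme \<Rightarrow> bool"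
  where "p_group p G \<longleftrightarrow> group G \<and> (\<exists>k. order G = p ^ k)"

definition sylow_subgroup :: "nat \<Rightarrow> 'a set \<Rightarrow> ('a, 'b) monoid_scheme \<Rightarrow> bool"
  where "sylow_subgroup p P G \<longleftrightarrow>
    subgroup P G \<and> card P = p ^ multiplicity p (order G)"

definition center :: "('a, 'b) monoid_scheme \<Rightarrow> 'a set"
  where "center G = {z \<in> carrier G. \<forall>x \<in> carrier G. z \<otimes>\<^bsub>G\<^esub> x = x \<otimes>\<^bsub>G\<^esub> z}"

text \<open>\<open>Z\<^sub>k\<^sub>+\<^sub>1(G)\<close> is the preimage of \<open>Z(G/Z\<^sub>k(G))\<close> under the quotient map.\<close>

primrec upper_central :: "('a, 'b) monoid_scheme \<Rightarrow> nat \<Rightarrow> 'a set"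
  where
    "upper_central G 0 = {\<one>\<^bsub>G\<^esub>}"
  | "upper_central G (Suc k) =
      {x \<in> carrier G. upper_central G k #>\<^bsub>G\<^esub> x \<in> center (G Mod upper_central G k)}"

text \<open>\<open>A\<^sup>p(G)\<close>: the least element, with respect to inclusion, among the normal subgroups whose
  quotient is an abelian \<open>p\<close>-group. Lemma \<open>Ap_least\<close> shows that it exists for finite \<open>G\<close>.\<close>

definition Ap :: "nat \<Rightarrow> ('a, 'b) monoid_scheme \<Rightarrow> 'a set"
  where "Ap p G = (LEAST N. N \<lhd> G \<and> comm_group (G Mod N) \<and> p_group p (G Mod N))"

text \<open>Control of \<open>p\<close>-transfer is only defined for subgroups of index coprime to \<open>p\<close>; the predicate
  includes this requirement.\<close>

definition controls_p_transfer :: "nat \<Rightarrow> 'a set \<Rightarrow> ('a, 'b) monoid_scheme \<Rightarrow> bool"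
  where "controls_p_transfer p N G \<longleftrightarrow>
    subgroup N G \<and> coprime (card (rcosets\<^bsub>G\<^esub> N)) p \<and>
    ((G\<lparr>carrier := N\<rparr>) Mod Ap p (G\<lparr>carrier := N\<rparr>)) \<cong> (G Mod Ap p G)"

lemma (in group) center_normal: "center G \<lhd> G"
proof (rule normal_invI)
  have 1: "inv a \<otimes> x = x \<otimes> inv a" if a: "a \<in> center G" and x: "x \<in> carrier G" for a x
  proof -
    have c: "a \<in> carrier G" and e: "a \<otimes> x = x \<otimes> a" using a x by (auto simp: center_def)
    have "inv a \<otimes> x = inv a \<otimes> (x \<otimes> a) \<otimes> inv a" using c x by (simp add: m_assoc)
    also have "\<dots> = x \<otimes> inv a" using c x by (simp flip: e m_assoc)
    finally show ?thesis .
  qed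
  have 2: "a \<otimes> b \<otimes> x = x \<otimes> (a \<otimes> b)"
    if "a \<in> center G" "b \<in> center G" "x \<in> carrier G" for a b x
    using that unfolding center_def mem_Collect_eq by (metis m_assoc)
  show "subgroup (center G) G"
  proof (rule subgroupI)
    show sub: "center G \<subseteq> carrier G" by (auto simp: center_def)
    show "center G \<noteq> {}" by (auto simp: center_def intro!: exI[of _ \<one>])
    show "inv a \<in> center G" if "a \<in> center G" for a
      unfolding center_def using inv_closed[of a] that sub 1[OF that] by blast
    show "a \<otimes> b \<in> center G" if "a \<in> center G" "b \<in> center G" for a b
      unfolding center_def using m_closed[of a b] that sub 2[OF that] by blast
  qed
  fix x h assume x: "x \<in> carrier G" and h: "h \<in> center G"
  have "x \<otimes> h = h \<otimes> x" "h \<in> carrier G" using x h unfolding center_def by auto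
  then have "x \<otimes> h \<otimes> inv x = h" using x by (simp add: m_assoc)
  then show "x \<otimes> h \<otimes> inv x \<in> center G" using h by simp
qed

lemma (in group) upper_central_normal: "upper_central G k \<lhd> G"
proof (induction k)
  case 0
  show ?case by (simp add: one_is_normal)
next
  case (Suc k)
  let ?Z = "upper_central G k"
  interpret N: normal ?Z G by (rule Suc)
  interpret Q: group "G Mod ?Z" by (rule N.factorgroup_is_group)
  interpret C: normal "center (G Mod ?Z)" "G Mod ?Z" by (rule Q.center_normal)
  interpret h: group_hom G "G Mod ?Z" "\<lambda>x. ?Z #> x"
    by (simp add: group_hom_def group_hom_axioms_def N.r_coset_hom_Mod is_group Q.is_group)
  show ?case
  proof (rule normal_invI)
    show "subgroup (upper_central G (Suc k)) G"
    proof (rule subgroupI)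
      show "upper_central G (Suc k) \<noteq> {}"
        using C.one_closed h.hom_one by auto
    next
      fix a assume "a \<in> upper_central G (Suc k)"
      then show "inv a \<in> upper_central G (Suc k)"
        using h.hom_inv[of a] C.m_inv_closed by auto
    next
      fix a b assume "a \<in> upper_central G (Suc k)" "b \<in> upper_central G (Suc k)"
      then show "a \<otimes> b \<in> upper_central G (Suc k)"
        using h.hom_mult[of a b] C.m_closed[of "?Z #> a" "?Z #> b"] by auto
    qed auto
    fix x y assume "x \<in> carrier G" "y \<in> upper_central G (Suc k)"
    then show "x \<otimes> y \<otimes> inv x \<in> upper_central G (Suc k)"
      using C.inv_op_closed2[of "?Z #> x" "?Z #> y"] h.hom_closed[of x]
      by (simp del: mult_FactGroup)
  qed
qed

lemma (in group) upper_central_1: "upper_central G (Suc 0) = center G"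
proof -
  have r: "{\<one>} #> x = {x}" if "x \<in> carrier G" for x
    using that by (auto simp: r_coset_def)
  have c: "carrier (G Mod {\<one>}) = (\<lambda>x. {x}) ` carrier G"
    using r by (auto simp: carrier_FactGroup)
  have "{x} \<in> center (G Mod {\<one>}) \<longleftrightarrow> x \<in> center G" if "x \<in> carrier G" for x
    unfolding center_def c mem_Collect_eq ball_simps mult_FactGroup set_mult_def
    using that by simp
  then have "{\<one>} #> x \<in> center (G Mod {\<one>}) \<longleftrightarrow> x \<in> center G" if "x \<in> carrier G" for x
    using that r by simp
  moreover have "center G \<subseteq> carrier G" unfolding center_def by blast
  ultimately show ?thesis unfolding upper_central.simps by blast
qed

lemma (in group) rcos_eq_iff:
  assumes "subgroup N G" "x \<in> carrier G" "y \<in> carrier G"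
  shows "N #> x = N #> y \<longleftrightarrow> x \<otimes> inv y \<in> N"
proof -
  interpret N: subgroup N G by fact
  have "x \<in> N #> y \<longleftrightarrow> x \<otimes> inv y \<in> N"
    by (rule N.rcos_module[OF is_group assms(3,2)])
  moreover have "x \<in> N #> x" by (rule rcos_self[OF assms(2,1)])
  moreover have "N #> y = N #> x" if "x \<in> N #> y"
    by (rule repr_independence[OF that assms(3,1)])
  ultimately show ?thesis by blast
qed

lemma (in group) comm_FactGroup_iff:
  assumes "N \<lhd> G"
  shows "comm_group (G Mod N) \<longleftrightarrow>
    (\<forall>x \<in> carrier G. \<forall>y \<in> carrier G. x \<otimes> y \<otimes> inv (y \<otimes> x) \<in> N)"
proof -
  interpret N: normal N G by fact
  interpret Q: group "G Mod N" by (rule N.factorgroup_is_group)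
  have "comm_group (G Mod N) \<longleftrightarrow>
    (\<forall>x \<in> carrier (G Mod N). \<forall>y \<in> carrier (G Mod N). x \<otimes>\<^bsub>(G Mod N)\<^esub> y = y \<otimes>\<^bsub>(G Mod N)\<^esub> x)"
    using Q.group_comm_groupI comm_groupE(4)[of "G Mod N"] by blast
  also have "\<dots> \<longleftrightarrow> (\<forall>x \<in> carrier G. \<forall>y \<in> carrier G. N #> (x \<otimes> y) = N #> (y \<otimes> x))"
    by (simp add: carrier_FactGroup N.rcos_sum)
  also have "\<dots> \<longleftrightarrow> (\<forall>x \<in> carrier G. \<forall>y \<in> carrier G. x \<otimes> y \<otimes> inv (y \<otimes> x) \<in> N)"
    by (intro ball_cong refl rcos_eq_iff N.subgroup_axioms m_closed)
  finally show ?thesis .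
qed

lemma (in group) Ap_inter:
  assumes p: "Factorial_Ring.prime p"
    and N: "N \<lhd> G" "comm_group (G Mod N)" "p_group p (G Mod N)"
    and M: "M \<lhd> G" "comm_group (G Mod M)" "p_group p (G Mod M)"
  shows "N \<inter> M \<lhd> G \<and> comm_group (G Mod (N \<inter> M)) \<and> p_group p (G Mod (N \<inter> M))"
proof -
  interpret N: normal N G by fact
  interpret M: normal M G by fact
  have NM: "N \<inter> M \<lhd> G"
    by (rule normal_invI) (auto simp: subgroups_Inter_pair N.subgroup_axioms M.subgroup_axioms
        N.inv_op_closed2 M.inv_op_closed2)
  interpret NM: normal "N \<inter> M" G by fact
  have cm: "comm_group (G Mod (N \<inter> M))"
    using N(2) M(2) comm_FactGroup_iff N(1) M(1) NM by simp
  let ?D = "(G Mod N) \<times>\<times> (G Mod M)"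
  let ?f = "\<lambda>x. (N #> x, M #> x)"
  interpret D: group ?D
    by (intro DirProd_group N.factorgroup_is_group M.factorgroup_is_group)
  have f: "?f \<in> hom G ?D"
    using N.r_coset_hom_Mod M.r_coset_hom_Mod by (auto simp: hom_def Pi_def)
  interpret f: group_hom G ?D ?f
    using f by (simp add: group_hom_def group_hom_axioms_def is_group D.is_group)
  have I: "subgroup (?f ` carrier G) ?D" by (rule f.img_is_subgroup)
  have ker: "kernel G ?D ?f = N \<inter> M"
  proof -
    have "N #> x = N \<longleftrightarrow> x \<in> N" "M #> x = M \<longleftrightarrow> x \<in> M" if "x \<in> carrier G" for x
      using coset_join1[OF _ that N.subgroup_axioms] coset_join1[OF _ that M.subgroup_axioms]
        coset_join2[OF that N.subgroup_axioms] coset_join2[OF that M.subgroup_axioms] by blast+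
    then show ?thesis
      using N.subset unfolding kernel_def one_DirProd one_FactGroup by blast
  qed
  let ?E = "?D\<lparr>carrier := ?f ` carrier G\<rparr>"
  interpret E: group ?E by (rule D.subgroup_imp_group[OF I])
  interpret g: group_hom G ?E ?f
    using f by (simp add: group_hom_def group_hom_axioms_def is_group E.is_group) (auto simp: hom_def)
  have "kernel G ?E ?f = N \<inter> M" using ker by (simp add: kernel_def)
  then have "G Mod (N \<inter> M) \<cong> ?E" using g.FactGroup_iso by simp
  then have "order (G Mod (N \<inter> M)) = card (?f ` carrier G)"
    unfolding order_def by (auto dest: iso_same_card)
  also have "\<dots> dvd order ?D"
    unfolding D.lagrange[OF I, symmetric] by (rule dvd_triv_right)
  finally have d: "order (G Mod (N \<inter> M)) dvd order ?D" .
  obtain a b where "order (G Mod N) = p ^ a" "order (G Mod M) = p ^ b"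
    using N(3) M(3) by (auto simp: p_group_def)
  then have "order ?D = p ^ (a + b)"
    by (simp add: order_def DirProd_def card_cartesian_product power_add)
  then have "\<exists>k. order (G Mod (N \<inter> M)) = p ^ k"
    using d divides_primepow_nat[OF p] by auto
  then show ?thesis
    using NM cm NM.factorgroup_is_group by (simp add: p_group_def)
qed

lemma (in group) Ap_least:
  assumes fin: "finite (carrier G)" and p: "Factorial_Ring.prime p"
  shows "Ap p G \<lhd> G" "comm_group (G Mod Ap p G)" "p_group p (G Mod Ap p G)"
    and "\<And>N. N \<lhd> G \<Longrightarrow> comm_group (G Mod N) \<Longrightarrow> p_group p (G Mod N) \<Longrightarrow> Ap p G \<subseteq> N"
proof -
  let ?P = "\<lambda>N. N \<lhd> G \<and> comm_group (G Mod N) \<and> p_group p (G Mod N)"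
  have n: "carrier G \<lhd> G"
    by (rule normal_invI) (auto simp: subgroup_self)
  interpret S: normal "carrier G" G by fact
  have "order (G Mod carrier G) = p ^ 0"
    using S.fact_group_trivial_iff[OF fin] by (simp add: order_def)
  then have top: "?P (carrier G)"
    using n S.factorgroup_is_group by (auto simp: p_group_def comm_FactGroup_iff simp del: power_0)
  obtain N where N: "?P N" and min: "\<And>M. ?P M \<Longrightarrow> card N \<le> card M"
    using ex_has_least_nat[of ?P _ card, OF top] by blast
  have finN: "finite N"
    using N fin by (meson finite_subset normal_imp_subgroup subgroup.subset)
  have le: "N \<subseteq> M" if M: "?P M" for M
  proof -
    have "card N \<le> card (N \<inter> M)" using Ap_inter[OF p] N M by (intro min) blast
    then show ?thesis using finN by (metis Int_lower1 card_seteq inf.absorb_iff1)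
  qed
  have "Ap p G = N"
    unfolding Ap_def by (rule Least_equality) (use N le in auto)
  then show "Ap p G \<lhd> G" "comm_group (G Mod Ap p G)" "p_group p (G Mod Ap p G)"
    and "\<And>N. N \<lhd> G \<Longrightarrow> comm_group (G Mod N) \<Longrightarrow> p_group p (G Mod N) \<Longrightarrow> Ap p G \<subseteq> N"
    using N le by auto
qed

end

theory Submission
  imports Defs
begin

text \<open>
  Let \<open>N = N\<^sub>G(P)\<close> and consider the transfer \<open>V : G \<rightarrow> N / A\<^sup>p(N)\<close>. Its target is an abelian
  \<open>p\<close>-group, so \<open>A\<^sup>p(G)\<close> lies in the kernel of \<open>V\<close>. Conversely \<open>G / A\<^sup>p(G)\<close> is a quotient of
  \<open>N / A\<^sup>p(N)\<close>, because \<open>N\<close> has index coprime to \<open>p\<close> and so maps onto every \<open>p\<close>-quotient of \<open>G\<close>. If \<open>V\<close>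
  is surjective, the two comparisons leave no room: the kernel of \<open>V\<close> is \<open>A\<^sup>p(G)\<close>, and \<open>V\<close> induces
  the isomorphism. So everything rests on surjectivity.

  Suppose that \<open>V\<close> is not surjective. Composing with a suitable power map modulo the image of \<open>V\<close>
  produces a nontrivial homomorphism \<open>\<phi>\<close> from \<open>N\<close> to an abelian group, with values of order
  dividing \<open>p\<close>, whose transfer to \<open>G\<close> is trivial. This is excluded by evaluating the transfer at a
  \<open>p\<close>-element \<open>x\<close> of \<open>N\<close> of least possible order with \<open>\<phi>(x) \<noteq> 1\<close>. A \<open>\<langle>x\<rangle>\<close>-orbit of length \<open>n > 1\<close> on
  the cosets of \<open>N\<close> contributes \<open>\<phi>\<close> of a conjugate of \<open>x\<^sup>n\<close>, whose order is smaller, and therefore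
  contributes \<open>1\<close>. The coset \<open>N\<close> contributes \<open>\<phi>(x)\<close>. There remain the fixed cosets \<open>Nt \<noteq> N\<close>; for
  these \<open>x\<close> lies in \<open>D = P \<inter> P\<^sup>t\<close>, a proper subgroup of \<open>P\<close> which depends only on the coset.

  Here the hypothesis enters, through the choice of an element \<open>y\<close> of \<open>P\<close> outside \<open>D\<close> that normalizes
  \<open>D\<close>, with \<open>y\<^sup>p \<in> D\<close>, such that \<open>y\<close> or all of \<open>D\<close> lies in \<open>Z\<^sub>p\<^sub>-\<^sub>1(P)\<close>. If \<open>D\<close> does not contain
  \<open>Z\<^sub>p\<^sub>-\<^sub>1(P)\<close>, the first term of the upper central series not contained in \<open>D\<close> supplies \<open>y\<close>; if it does,
  then \<open>D = Z\<^sub>p\<^sub>-\<^sub>1(P)\<close> by the bound on \<open>|D|\<close>, and \<open>y\<close> may be taken anywhere in \<open>P\<close> outside \<open>D\<close>.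
  Multiplication by \<open>y\<close> permutes the fixed cosets with the same \<open>D\<close> in cycles of length exactly \<open>p\<close>, and one
  cycle contributes \<open>\<Prod>\<^sub>i\<^sub><\<^sub>p \<lambda>(y\<^sup>i x y\<^sup>-\<^sup>i)\<close>, where \<open>\<lambda>(d) = \<phi>(t d t\<^sup>-\<^sup>1)\<close>. Written in terms of iterated
  commutators, this is a product of \<open>p\<close>-th powers and the value of \<open>\<lambda>\<close> at the \<open>(p-1)\<close>-fold commutator of \<open>x\<close> with
  \<open>y\<close>. The former vanish since \<open>\<phi>\<close> has exponent \<open>p\<close>, the latter by the choice of \<open>y\<close>. Hence
  \<open>V(x) = \<phi>(x) \<noteq> 1\<close>.

  The steps are carried by \<open>finprod_conjugates_eq_one\<close>, \<open>exists_central_normalizing_element\<close>,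
  \<open>transfer_eq_fixed_product\<close>, \<open>transfer_nontrivial\<close> and \<open>p_group_transfer_surjective\<close>.
\<close>

section \<open>Products over orbits and iterated differences\<close>

text \<open>A product is computed orbit by orbit under a permutation of the index set: the orbit of \<open>c\<close> is
\<open>c, \<sigma> c, \<dots>, \<sigma>\<^sup>n\<^sup>-\<^sup>1 c\<close> for the least period \<open>n\<close>. Assuming a common period \<open>m\<close> spares a separate
injectivity hypothesis and gives control over the orbit lengths.\<close>

lemma (in comm_monoid) finprod_eq_one_by_orbits:
  assumes fin: "finite F"
    and inv: "\<And>c. c \<in> F \<Longrightarrow> \<sigma> c \<in> F"
    and m: "0 < m" and per: "\<And>c. c \<in> F \<Longrightarrow> (\<sigma> ^^ m) c = c"
    and cl: "\<And>c. c \<in> F \<Longrightarrow> \<psi> c \<in> carrier G"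
    and orb: "\<And>c n. c \<in> F \<Longrightarrow> 0 < n \<Longrightarrow> (\<sigma> ^^ n) c = c
      \<Longrightarrow> (\<And>i. 0 < i \<Longrightarrow> i < n \<Longrightarrow> (\<sigma> ^^ i) c \<noteq> c)
      \<Longrightarrow> finprod G (\<lambda>i. \<psi> ((\<sigma> ^^ i) c)) {..<n} = \<one>"
  shows "finprod G \<psi> F = \<one>"
  using fin inv per cl orb
proof (induction F rule: finite_psubset_induct)
  case (psubset F)
  show ?case
  proof (cases "F = {}")
    case False
    then obtain c where c: "c \<in> F" by blast
    have it: "(\<sigma> ^^ i) b \<in> F" if "b \<in> F" for i b
      using that psubset.prems(1) by (induction i) auto
    define n where "n = (LEAST n. 0 < n \<and> (\<sigma> ^^ n) c = c)"
    have n: "0 < n" "(\<sigma> ^^ n) c = c"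
      using LeastI[of "\<lambda>n. 0 < n \<and> (\<sigma> ^^ n) c = c" m] m psubset.prems(2)[OF c]
      unfolding n_def by auto
    have min: "(\<sigma> ^^ i) c \<noteq> c" if "0 < i" "i < n" for i
      using not_less_Least[of i "\<lambda>n. 0 < n \<and> (\<sigma> ^^ n) c = c"] that unfolding n_def by blast
    define B where "B = (\<lambda>i. (\<sigma> ^^ i) c) ` {..<n}"
    have BF: "B \<subseteq> F" and cB: "c \<in> B"
      using it[OF c] n(1) unfolding B_def by (auto intro!: image_eqI[of _ _ 0])
    have diff: "(\<sigma> ^^ i) c \<noteq> (\<sigma> ^^ j) c" if "i < j" "j < n" for i j
    proof
      assume e: "(\<sigma> ^^ i) c = (\<sigma> ^^ j) c"
      have "(\<sigma> ^^ (n - j + i)) c = (\<sigma> ^^ (n - j + j)) c"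
        using e by (simp only: funpow_add o_apply)
      then have "(\<sigma> ^^ (n - j + i)) c = c" using that n by simp
      moreover have "(\<sigma> ^^ (n - j + i)) c \<noteq> c" by (rule min) (use that in auto)
      ultimately show False by (rule notE[rotated])
    qed
    have inj: "inj_on (\<lambda>i. (\<sigma> ^^ i) c) {..<n}"
    proof (rule linorder_inj_onI)
      fix i j assume "i < j" "i \<in> {..<n}" "j \<in> {..<n}"
      then show "(\<sigma> ^^ i) c \<noteq> (\<sigma> ^^ j) c" using diff[of i j] by simp
    qed auto
    have "finprod G \<psi> B = finprod G (\<lambda>i. \<psi> ((\<sigma> ^^ i) c)) {..<n}"
      unfolding B_def by (rule finprod_reindex[OF _ inj]) (use psubset.prems(3) it c in auto)
    also have "\<dots> = \<one>" by (rule psubset.prems(4)[OF c n min])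
    finally have B1: "finprod G \<psi> B = \<one>" .
    have Bn: "(\<sigma> ^^ j) b \<in> B" if b: "b \<in> B" for b j
    proof -
      obtain i where i: "b = (\<sigma> ^^ i) c" using b unfolding B_def by blast
      have "(\<sigma> ^^ j) b = (\<sigma> ^^ ((j + i) mod n)) c"
        unfolding i using funpow_mod_eq[OF n(2), of "j + i"] by (simp add: funpow_add)
      then show ?thesis using n(1) unfolding B_def by auto
    qed
    have rest: "\<sigma> b \<in> F - B" if b: "b \<in> F - B" for b
    proof -
      have "\<sigma> b \<in> B \<Longrightarrow> (\<sigma> ^^ (m - 1)) (\<sigma> b) \<in> B" by (rule Bn)
      moreover have "(\<sigma> ^^ (m - 1)) (\<sigma> b) = b"
        using psubset.prems(2)[of b] b m by (cases m) (simp_all add: funpow_swap1)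
      ultimately show ?thesis using b psubset.prems(1) by auto
    qed
    have R1: "finprod G \<psi> (F - B) = \<one>"
    proof (rule psubset.IH)
      show "F - B \<subset> F" using cB c by blast
    qed (use rest psubset.prems in auto)
    have "finprod G \<psi> (B \<union> (F - B)) = finprod G \<psi> B \<otimes> finprod G \<psi> (F - B)"
      using psubset.hyps BF psubset.prems(3)
      by (intro finprod_Un_disjoint) (auto intro: finite_subset)
    then show ?thesis using BF B1 R1 by (simp add: Un_absorb1)
  qed simp
qed

lemma (in comm_monoid) finprod_lessThan_Suc_shift:
  fixes f :: "nat \<Rightarrow> 'a"
  assumes "\<And>i. f i \<in> carrier G"
  shows "finprod G f {..<Suc n} = f 0 \<otimes> finprod G (\<lambda>i. f (Suc i)) {..<n}"
  using finprod_Suc2[of f "n - 1"] finprod_0[of f] assms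
  by (cases n) (auto simp: lessThan_Suc_atMost Pi_def m_comm lessThan_Suc)

text \<open>Newton's summation formula, written multiplicatively: \<open>w m i\<close> plays the role of the \<open>m\<close>-th
difference at \<open>i\<close> of the sequence \<open>w 0\<close>, and the sum of the first \<open>n\<close> terms of a sequence is
\<open>\<Sum>\<^sub>m \<Delta>\<^sup>m w(0) \<cdot> (n choose m+1)\<close>. For \<open>n = p\<close> prime all binomial coefficients except the last are
divisible by \<open>p\<close>.\<close>

lemma (in comm_monoid) finprod_eq_finprod_differences:
  fixes w :: "nat \<Rightarrow> nat \<Rightarrow> 'a"
  assumes cl: "\<And>m i. w m i \<in> carrier G"
    and step: "\<And>m i. w m (Suc i) = w (Suc m) i \<otimes> w m i"
  shows "finprod G (w 0) {..<n} = finprod G (\<lambda>m. w m 0 [^] (n choose Suc m)) {..<n}"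
  using assms
proof (induction n arbitrary: w)
  case 0
  then show ?case by simp
next
  case (Suc n)
  let ?a = "\<lambda>m. w m 0"
  note cl[simp] = Suc.prems(1)
  have "finprod G (w 0) {..<Suc n} = w 0 0 \<otimes> finprod G (\<lambda>i. w 0 (Suc i)) {..<n}"
    by (rule finprod_lessThan_Suc_shift) simp
  also have "finprod G (\<lambda>i. w 0 (Suc i)) {..<n}
      = finprod G (\<lambda>m. w m (Suc 0) [^] (n choose Suc m)) {..<n}"
    by (rule Suc.IH[of "\<lambda>m i. w m (Suc i)"]) (use Suc.prems in auto)
  also have "\<dots> = finprod G (\<lambda>m. ?a (Suc m) [^] (n choose Suc m) \<otimes> ?a m [^] (n choose Suc m)) {..<n}"
    by (rule finprod_cong') (auto simp: Suc.prems(2) nat_pow_distrib)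
  also have "\<dots> = finprod G (\<lambda>m. ?a (Suc m) [^] (n choose Suc m)) {..<n}
      \<otimes> finprod G (\<lambda>m. ?a m [^] (n choose Suc m)) {..<n}"
    by (rule finprod_multf) auto
  finally have L: "finprod G (w 0) {..<Suc n} = w 0 0 \<otimes>
      (finprod G (\<lambda>m. ?a (Suc m) [^] (n choose Suc m)) {..<n}
      \<otimes> finprod G (\<lambda>m. ?a m [^] (n choose Suc m)) {..<n})" .
  have "finprod G (\<lambda>m. ?a m [^] (Suc n choose Suc m)) {..<Suc n}
      = finprod G (\<lambda>m. ?a m [^] (n choose m) \<otimes> ?a m [^] (n choose Suc m)) {..<Suc n}"
    by (rule finprod_cong') (auto simp: nat_pow_mult)
  also have "\<dots> = finprod G (\<lambda>m. ?a m [^] (n choose m)) {..<Suc n}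
      \<otimes> finprod G (\<lambda>m. ?a m [^] (n choose Suc m)) {..<Suc n}"
    by (rule finprod_multf) auto
  also have "finprod G (\<lambda>m. ?a m [^] (n choose m)) {..<Suc n}
      = w 0 0 \<otimes> finprod G (\<lambda>m. ?a (Suc m) [^] (n choose Suc m)) {..<n}"
    by (subst finprod_lessThan_Suc_shift) auto
  also have "finprod G (\<lambda>m. ?a m [^] (n choose Suc m)) {..<Suc n}
      = finprod G (\<lambda>m. ?a m [^] (n choose Suc m)) {..<n}"
    using finprod_insert[of "{..<n}" n "\<lambda>m. ?a m [^] (n choose Suc m)"]
    by (simp add: lessThan_Suc Pi_def binomial_eq_0)
  finally show ?case using L by (simp add: m_assoc)
qed

section \<open>Powers and conjugates\<close>

lemma (in group) inv_mult_cancel_left: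
  "x \<in> carrier G \<Longrightarrow> y \<in> carrier G \<Longrightarrow> inv x \<otimes> (x \<otimes> y) = y"
  by (simp flip: m_assoc)

lemma (in group) mult_inv_cancel_left:
  "x \<in> carrier G \<Longrightarrow> y \<in> carrier G \<Longrightarrow> x \<otimes> (inv x \<otimes> y) = y"
  by (simp flip: m_assoc)

lemma (in group) conj_nat_pow:
  assumes "t \<in> carrier G" "x \<in> carrier G"
  shows "(t \<otimes> x \<otimes> inv t) [^] (m :: nat) = t \<otimes> x [^] m \<otimes> inv t"
  using assms by (induction m) (simp_all add: m_assoc inv_mult_cancel_left)

lemma (in subgroup) nat_pow_mem:
  assumes "group G" "x \<in> H" shows "x [^] (m :: nat) \<in> H"
proof -
  interpret group G by fact
  show ?thesis using assms(2) by (induction m) auto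
qed

lemma (in subgroup) mem_of_coprime_powers:
  assumes G: "group G" and y: "y \<in> carrier G" and c: "coprime m (n :: nat)"
    and "y [^] m \<in> H" "y [^] n \<in> H"
  shows "y \<in> H"
proof (cases "n = 1")
  case False
  interpret group G by fact
  obtain u v where uv: "m * u = n * v + 1" using coprime_bezout_strong[OF c False] by blast
  have 1: "y [^] (n * v) \<in> H" "y [^] (m * u) \<in> H"
    using nat_pow_mem[OF G assms(4), of u] nat_pow_mem[OF G assms(5), of v] y
    by (simp_all add: nat_pow_pow)
  have "y = inv (y [^] (n * v)) \<otimes> y [^] (m * u)"
    unfolding uv using y by (simp add: inv_mult_cancel_left)
  then show ?thesis
    using subgroup.m_closed[OF subgroup_axioms subgroup.m_inv_closed[OF subgroup_axioms 1(1)] 1(2)]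
    by simp
next
  case True
  interpret group G by fact
  show ?thesis using assms(5) y by (simp add: True)
qed

section \<open>Commutators and the upper central series\<close>

lemma (in group) mem_upper_central_Suc_iff:
  "x \<in> upper_central G (Suc k) \<longleftrightarrow>
    x \<in> carrier G \<and> (\<forall>g \<in> carrier G. x \<otimes> g \<otimes> inv x \<otimes> inv g \<in> upper_central G k)"
proof -
  let ?Z = "upper_central G k"
  interpret Z: normal ?Z G by (rule upper_central_normal)
  have "?Z #> x \<in> center (G Mod ?Z) \<longleftrightarrow>
      (\<forall>g \<in> carrier G. x \<otimes> g \<otimes> inv x \<otimes> inv g \<in> ?Z)" if x: "x \<in> carrier G"
  proof -
    have "?Z #> x \<in> center (G Mod ?Z) \<longleftrightarrow>
        (\<forall>g \<in> carrier G. ?Z #> (x \<otimes> g) = ?Z #> (g \<otimes> x))"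
      using x by (auto simp: center_def carrier_FactGroup Z.rcos_sum)
    also have "\<dots> \<longleftrightarrow> (\<forall>g \<in> carrier G. x \<otimes> g \<otimes> inv (g \<otimes> x) \<in> ?Z)"
      by (intro ball_cong refl rcos_eq_iff Z.subgroup_axioms m_closed x)
    finally show ?thesis using x by (simp add: inv_mult_group m_assoc)
  qed
  then show ?thesis by auto
qed

lemma (in group) commutator_mem_upper_central:
  assumes "x \<in> upper_central G (Suc k)" "g \<in> carrier G"
  shows "x \<otimes> g \<otimes> inv x \<otimes> inv g \<in> upper_central G k"
    and "g \<otimes> x \<otimes> inv g \<otimes> inv x \<in> upper_central G k"
proof -
  interpret Z: normal "upper_central G k" G by (rule upper_central_normal)
  have x: "x \<in> carrier G" using assms(1) by simp
  show 1: "x \<otimes> g \<otimes> inv x \<otimes> inv g \<in> upper_central G k"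
    using assms by (simp add: mem_upper_central_Suc_iff del: upper_central.simps)
  have "g \<otimes> x \<otimes> inv g \<otimes> inv x = inv (x \<otimes> g \<otimes> inv x \<otimes> inv g)"
    using x assms(2) by (simp add: inv_mult_group m_assoc)
  then show "g \<otimes> x \<otimes> inv g \<otimes> inv x \<in> upper_central G k"
    using 1 by simp
qed

text \<open>With \<open>E(d) = y d y\<^sup>-\<^sup>1 d\<^sup>-\<^sup>1\<close>, the values of \<open>l \<circ> E\<^sup>m\<close> at the conjugates \<open>y\<^sup>i d y\<^sup>-\<^sup>i\<close> are the iterated differences of
the sequence of values of \<open>l\<close>. The summation formula leaves only \<open>l(E\<^sup>p\<^sup>-\<^sup>1(d))\<close>, and each
application of \<open>E\<close> descends one step in the upper central series, starting either from \<open>d\<close> or, with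
the first commutator, from \<open>y\<close>.\<close>

lemma (in group) finprod_conjugates_eq_one:
  assumes p: "Factorial_Ring.prime (p :: nat)" and C: "comm_group C"
    and D: "subgroup D G" and y: "y \<in> carrier G"
    and conj: "\<And>d. d \<in> D \<Longrightarrow> y \<otimes> d \<otimes> inv y \<in> D"
    and Z: "y \<in> upper_central G (p - 1) \<or> D \<subseteq> upper_central G (p - 1)"
    and l: "l \<in> hom (G\<lparr>carrier := D\<rparr>) C" and exp: "\<And>d. d \<in> D \<Longrightarrow> l d [^]\<^bsub>C\<^esub> p = \<one>\<^bsub>C\<^esub>"
    and d: "d \<in> D"
  shows "finprod C (\<lambda>i. l (y [^] i \<otimes> d \<otimes> inv (y [^] i))) {..<p} = \<one>\<^bsub>C\<^esub>"
proof -
  interpret C: comm_group C by fact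
  interpret D: subgroup D G by fact
  define T where "T d = y \<otimes> d \<otimes> inv y" for d
  define E where "E d = T d \<otimes> inv d" for d
  have lm: "l (a \<otimes> b) = l a \<otimes>\<^bsub>C\<^esub> l b" if "a \<in> D" "b \<in> D" for a b
    using l that by (auto simp: hom_def)
  have lc: "l a \<in> carrier C" if "a \<in> D" for a
    using l that by (auto simp: hom_def)
  have TD: "T a \<in> D" if "a \<in> D" for a using conj that by (simp add: T_def)
  have ED: "E a \<in> D" if "a \<in> D" for a using TD that by (simp add: E_def)
  have TiD: "(T ^^ i) a \<in> D" if "a \<in> D" for a i using that by (induction i) (auto intro: TD)
  have EiD: "(E ^^ i) a \<in> D" if "a \<in> D" for a i using that by (induction i) (auto intro: ED)
  \<comment> \<open>The maps \<open>T\<close> and \<open>E\<close> commute although \<open>E\<close> is not a homomorphism.\<close>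
  have TE: "T (E a) = E (T a)" if a: "a \<in> D" for a
    using D.mem_carrier[OF a] y
    by (simp add: T_def E_def m_assoc inv_mult_group inv_mult_cancel_left)
  have TEi: "T ((E ^^ i) a) = (E ^^ i) (T a)" if "a \<in> D" for i a
    using that by (induction i) (auto simp: TE EiD)
  have Tpow: "(T ^^ i) d = y [^] i \<otimes> d \<otimes> inv (y [^] i)" for i
  proof (induction i)
    case (Suc i)
    have e: "y [^] Suc i = y \<otimes> y [^] i" using y by (rule nat_pow_Suc2)
    show ?case
      using Suc D.mem_carrier[OF d] y unfolding e by (simp add: T_def m_assoc inv_mult_group)
  qed (use D.mem_carrier[OF d] in simp)
  define w where "w m i = l ((E ^^ m) ((T ^^ i) d))" for m i
  have wc: "w m i \<in> carrier C" for m i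
    unfolding w_def by (intro lc EiD TiD d)
  have "w m (Suc i) = w (Suc m) i \<otimes>\<^bsub>C\<^esub> w m i" for m i
  proof -
    let ?b = "(E ^^ m) ((T ^^ i) d)"
    have b: "?b \<in> D" by (intro EiD TiD d)
    have "w m (Suc i) = l (T ?b)" unfolding w_def by (simp add: TEi TiD d)
    also have "T ?b = E ?b \<otimes> ?b"
      using D.mem_carrier[OF b] D.mem_carrier[OF TD[OF b]] by (simp add: E_def m_assoc)
    finally show ?thesis using b ED[OF b] by (simp add: lm w_def)
  qed
  from C.finprod_eq_finprod_differences[of w, OF wc this, where n = p]
  have "finprod C (w 0) {..<p} = finprod C (\<lambda>m. w m 0 [^]\<^bsub>C\<^esub> (p choose Suc m)) {..<p}" .
  also have "\<dots> = \<one>\<^bsub>C\<^esub>"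
  proof (rule C.finprod_one_eqI)
    fix m assume m: "m \<in> {..<p}"
    show "w m 0 [^]\<^bsub>C\<^esub> (p choose Suc m) = \<one>\<^bsub>C\<^esub>"
    proof (cases "Suc m = p")
      case False
      then have "p dvd p choose Suc m"
        using m p by (intro dvd_choose_prime) auto
      then obtain c where c: "p choose Suc m = p * c" ..
      have "w m 0 [^]\<^bsub>C\<^esub> p = \<one>\<^bsub>C\<^esub>" unfolding w_def by (intro exp EiD TiD d)
      then show ?thesis unfolding c using C.nat_pow_pow[OF wc, of m 0 p c] by simp
    next
      case True
      define Zc where "Zc = upper_central G"
      have dn: "(E ^^ j) a \<in> Zc k" if "a \<in> Zc (j + k)" for j k a
        using that
      proof (induction j arbitrary: a)
        case (Suc j)
        have "a \<in> carrier G" using Suc.prems by (simp add: Zc_def mem_upper_central_Suc_iff)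
        then have "E a \<in> Zc (j + k)"
          using commutator_mem_upper_central(2)[of a "j + k" y] Suc.prems y
          by (simp add: Zc_def E_def T_def del: upper_central.simps)
        from Suc.IH[OF this] show ?case by (simp add: funpow_swap1)
      qed simp
      have "(E ^^ m) d \<in> Zc 0"
        using Z
      proof
        assume "D \<subseteq> upper_central G (p - 1)"
        then show ?thesis using dn[of d m 0] d True by (auto simp: Zc_def)
      next
        \<comment> \<open>The first commutator \<open>E d = [y, d]\<close> already lies in \<open>Z\<^sub>p\<^sub>-\<^sub>2\<close>, so one step is gained
          from \<open>y\<close> and the remaining \<open>p - 2\<close> from the descent.\<close>
        assume yZ: "y \<in> upper_central G (p - 1)"
        obtain q where q: "m = Suc q"
          using True prime_ge_2_nat[OF p] by (cases m) auto
        have "E d \<in> Zc q"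
          using commutator_mem_upper_central(1)[of y q d] yZ True q D.mem_carrier[OF d]
          by (auto simp: Zc_def E_def T_def simp del: upper_central.simps)
        then show ?thesis using dn[of "E d" q 0] q by (simp add: funpow_swap1)
      qed
      then have "w m 0 = l \<one>" by (simp add: w_def Zc_def)
      also have "\<dots> = \<one>\<^bsub>C\<^esub>"
        using lm[of "\<one>" "\<one>"] lc[of "\<one>"] by (simp add: C.l_cancel_one)
      finally show ?thesis by simp
    qed
  qed
  finally show ?thesis by (simp add: w_def[abs_def] Tpow)
qed

text \<open>If \<open>Z\<^sub>j\<close> is the first term of the upper central series not contained in \<open>D\<close>, then
\<open>[Z\<^sub>j, D] \<subseteq> Z\<^sub>j\<^sub>-\<^sub>1 \<subseteq> D\<close>, so every element of \<open>Z\<^sub>j\<close> normalizes \<open>D\<close>. If no such \<open>j \<le> n\<close> exists, the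
bound on the cardinality forces \<open>D = Z\<^sub>n\<close>, which is normalized by everything.\<close>

lemma (in group) exists_central_normalizing_element:
  assumes fin: "finite (carrier G)" and ord: "order G = p ^ e" and D: "subgroup D G"
    and proper: "D \<noteq> carrier G" and le: "card D \<le> card (upper_central G n)"
  shows "\<exists>y \<in> carrier G - D. y [^] p \<in> D \<and> (\<forall>d \<in> D. y \<otimes> d \<otimes> inv y \<in> D) \<and>
    (y \<in> upper_central G n \<or> D \<subseteq> upper_central G n)"
proof -
  let ?Z = "upper_central G"
  interpret D: subgroup D G by fact
  interpret Z: normal "?Z n" G by (rule upper_central_normal)
  have "\<exists>y \<in> carrier G - D. (\<forall>d \<in> D. y \<otimes> d \<otimes> inv y \<in> D) \<and> (y \<in> ?Z n \<or> D \<subseteq> ?Z n)"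
  proof (cases "?Z n \<subseteq> D")
    case True
    then have "D = ?Z n"
      using le fin D.subset by (metis card_seteq finite_subset)
    then show ?thesis using proper D.subset Z.inv_op_closed2 by blast
  next
    case False
    define j where "j = (LEAST j. \<not> ?Z j \<subseteq> D)"
    have j: "\<not> ?Z j \<subseteq> D" unfolding j_def by (rule LeastI[of _ n]) (rule False)
    have jn: "j \<le> n" unfolding j_def by (rule Least_le) (rule False)
    obtain i where i: "j = Suc i"
      using j D.one_closed by (cases j) auto
    have iD: "?Z i \<subseteq> D" using not_less_Least[of i "\<lambda>j. \<not> ?Z j \<subseteq> D"] i by (auto simp: j_def)
    obtain y where y: "y \<in> ?Z j" "y \<notin> D" using j by blast
    have yc: "y \<in> carrier G" using y(1) by (simp add: i)
    have "y \<otimes> d \<otimes> inv y \<in> D" if d: "d \<in> D" for d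
    proof -
      have "y \<otimes> d \<otimes> inv y \<otimes> inv d \<in> D"
        using commutator_mem_upper_central(1)[of y i d] y(1) D.mem_carrier[OF d] iD
        unfolding i by blast
      then have "y \<otimes> d \<otimes> inv y \<otimes> inv d \<otimes> d \<in> D" using d by simp
      then show ?thesis using yc D.mem_carrier[OF d] by (simp add: m_assoc)
    qed
    moreover have "?Z k \<subseteq> ?Z (Suc k)" for k
    proof
      interpret Y: normal "?Z k" G by (rule upper_central_normal)
      fix x assume x: "x \<in> ?Z k"
      have "x \<otimes> g \<otimes> inv x \<otimes> inv g \<in> ?Z k" if g: "g \<in> carrier G" for g
        using Y.m_closed[OF x Y.inv_op_closed2[OF g Y.m_inv_closed[OF x]]] x g by (simp add: m_assoc)
      then show "x \<in> ?Z (Suc k)" using x by (simp add: mem_upper_central_Suc_iff del: upper_central.simps)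
    qed
    then have "?Z j \<subseteq> ?Z n" using lift_Suc_mono_le[of ?Z, OF _ jn] by blast
    ultimately show ?thesis using y yc by blast
  qed
  then obtain y where y: "y \<in> carrier G" "y \<notin> D"
    and cj: "\<And>d. d \<in> D \<Longrightarrow> y \<otimes> d \<otimes> inv y \<in> D" and yZ: "y \<in> ?Z n \<or> D \<subseteq> ?Z n" by blast
  \<comment> \<open>The last of the powers \<open>y [^] p ^ k\<close> outside \<open>D\<close> inherits all other properties of \<open>y\<close>
    and has its \<open>p\<close>-th power in \<open>D\<close>.\<close>
  define k where "k = (LEAST k. y [^] (p ^ k) \<in> D)"
  have "y [^] (p ^ e) \<in> D" using pow_order_eq_1[OF y(1)] ord by simp
  then have k: "y [^] (p ^ k) \<in> D" unfolding k_def by (rule LeastI)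
  obtain i where i: "k = Suc i" using k y by (cases k) auto
  let ?x = "y [^] (p ^ i)"
  have x: "?x \<notin> D" using not_less_Least[of i "\<lambda>k. y [^] (p ^ k) \<in> D"] i by (auto simp: k_def)
  have "y [^] m \<otimes> d \<otimes> inv (y [^] m) \<in> D" if d: "d \<in> D" for d and m :: nat
  proof (induction m)
    case (Suc m)
    have e: "y [^] Suc m = y \<otimes> y [^] m" using y(1) by (rule nat_pow_Suc2)
    from cj[OF Suc] show ?case
      unfolding e using y(1) D.mem_carrier[OF d] by (simp add: inv_mult_group m_assoc)
  qed (use d in simp)
  moreover have "?x [^] p \<in> D" using k y(1) by (simp add: i nat_pow_pow mult.commute)
  moreover have "y [^] m \<in> ?Z n" if "y \<in> ?Z n" for m :: nat
    using that by (induction m) auto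
  ultimately show ?thesis using x y(1) yZ by blast
qed

section \<open>The transfer homomorphism\<close>

locale transfer_setting = group G for G (structure) +
  fixes N and C :: "('c, 'd) monoid_scheme" and \<phi>
  assumes finite_carrier: "finite (carrier G)" and subgroup_N: "subgroup N G"
    and comm_group_C: "comm_group C" and phi_hom: "\<phi> \<in> hom (G\<lparr>carrier := N\<rparr>) C"

sublocale transfer_setting \<subseteq> C: comm_group C
  by (rule comm_group_C)

sublocale transfer_setting \<subseteq> N: subgroup N G
  by (rule subgroup_N)

definition coset_rep :: "'a set \<Rightarrow> 'a"
  where "coset_rep c = (SOME x. x \<in> c)"

text \<open>The element \<open>coset_rep c \<otimes> g \<otimes> inv coset_rep (c #> g)\<close> lies in \<open>N\<close> for a right coset \<open>c\<close> of \<open>N\<close>; the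
transfer is the product of the values of \<open>\<phi>\<close> there. The individual factor is kept as a function of
its own because it is a cocycle for the action of \<open>G\<close> on the cosets.\<close>

definition transfer_factor ::
    "('a, 'b) monoid_scheme \<Rightarrow> ('a \<Rightarrow> 'c) \<Rightarrow> 'a set \<Rightarrow> 'a \<Rightarrow> 'c"
  where "transfer_factor G \<phi> c g =
    \<phi> (coset_rep c \<otimes>\<^bsub>G\<^esub> g \<otimes>\<^bsub>G\<^esub> inv\<^bsub>G\<^esub> coset_rep (c #>\<^bsub>G\<^esub> g))"

definition group_transfer :: "('a, 'b) monoid_scheme \<Rightarrow> 'a set \<Rightarrow> ('c, 'd) monoid_scheme \<Rightarrow>
    ('a \<Rightarrow> 'c) \<Rightarrow> 'a \<Rightarrow> 'c"
  where "group_transfer G N C \<phi> g = finprod C (\<lambda>c. transfer_factor G \<phi> c g) (rcosets\<^bsub>G\<^esub> N)"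

context transfer_setting
begin

lemma phi_mult: "a \<in> N \<Longrightarrow> b \<in> N \<Longrightarrow> \<phi> (a \<otimes> b) = \<phi> a \<otimes>\<^bsub>C\<^esub> \<phi> b"
  using phi_hom by (auto simp: hom_def)

lemma phi_closed: "a \<in> N \<Longrightarrow> \<phi> a \<in> carrier C"
  using phi_hom by (auto simp: hom_def)

lemma phi_one: "\<phi> \<one> = \<one>\<^bsub>C\<^esub>"
  using phi_mult[of \<one> \<one>] phi_closed[of \<one>] by (simp add: C.l_cancel_one)

lemma phi_conj:
  assumes "n \<in> N" "a \<in> N"
  shows "\<phi> (n \<otimes> a \<otimes> inv n) = \<phi> a"
proof -
  have "\<phi> (n \<otimes> a \<otimes> inv n) = \<phi> a \<otimes>\<^bsub>C\<^esub> (\<phi> n \<otimes>\<^bsub>C\<^esub> \<phi> (inv n))"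
    using assms by (simp add: phi_mult phi_closed C.m_ac)
  also have "\<phi> n \<otimes>\<^bsub>C\<^esub> \<phi> (inv n) = \<one>\<^bsub>C\<^esub>"
    using assms by (simp add: phi_one flip: phi_mult)
  finally show ?thesis using assms by (simp add: phi_closed)
qed

lemma finite_rcosets: "finite (rcosets N)"
  using finite_carrier by (simp add: RCOSETS_def)

lemma rcoset_subset: "c \<in> rcosets N \<Longrightarrow> c \<subseteq> carrier G"
  by (rule N.rcosets_carrier[OF is_group])

lemma coset_rep_mem:
  assumes "c \<in> rcosets N"
  shows "coset_rep c \<in> c" "coset_rep c \<in> carrier G" "c = N #> coset_rep c"
proof -
  obtain t where t: "t \<in> carrier G" "c = N #> t" using assms by (auto simp: RCOSETS_def)
  then have "t \<in> c" using rcos_self subgroup_N by blast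
  then show 1: "coset_rep c \<in> c" unfolding coset_rep_def by (rule someI)
  then show "coset_rep c \<in> carrier G" using rcoset_subset[OF assms] by blast
  show "c = N #> coset_rep c"
    using repr_independence[of "coset_rep c" N t] 1 t subgroup_N by auto
qed

lemma rcoset_act:
  assumes "c \<in> rcosets N" "g \<in> carrier G"
  shows "c #> g \<in> rcosets N"
  using coset_rep_mem[OF assms(1)] assms
  by (metis N.subset coset_mult_assoc m_closed rcosetsI)

lemma rcoset_act_mult:
  assumes "c \<in> rcosets N" "g \<in> carrier G" "h \<in> carrier G"
  shows "c #> g #> h = c #> (g \<otimes> h)"
  using assms rcoset_subset by (intro coset_mult_assoc)

lemma rcoset_act_one: "c \<in> rcosets N \<Longrightarrow> c #> \<one> = c"
  using rcoset_subset by (intro coset_mult_one)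

lemma rcoset_act_eq_iff:
  assumes "t \<in> carrier G" "g \<in> carrier G"
  shows "N #> t #> g = N #> t \<longleftrightarrow> t \<otimes> g \<otimes> inv t \<in> N"
  using rcos_eq_iff[OF subgroup_N, of "t \<otimes> g" t] assms by (simp add: coset_mult_assoc N.subset)

lemma transfer_factor_arg_mem:
  assumes "c \<in> rcosets N" "g \<in> carrier G"
  shows "coset_rep c \<otimes> g \<otimes> inv coset_rep (c #> g) \<in> N"
proof -
  note 1 = coset_rep_mem[OF assms(1)] and 2 = coset_rep_mem[OF rcoset_act[OF assms]]
  have "N #> (coset_rep c \<otimes> g) = N #> coset_rep (c #> g)"
    using 1 2 assms(2) by (metis N.subset coset_mult_assoc)
  then show ?thesis
    using rcos_eq_iff[OF subgroup_N, of "coset_rep c \<otimes> g" "coset_rep (c #> g)"] 1 2 assms(2)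
    by simp
qed

lemma transfer_factor_closed:
  assumes "c \<in> rcosets N" "g \<in> carrier G"
  shows "transfer_factor G \<phi> c g \<in> carrier C"
  unfolding transfer_factor_def by (intro phi_closed transfer_factor_arg_mem assms)

text \<open>The cocycle identity. It yields both that the transfer is a homomorphism and that
the factors along an orbit telescope.\<close>

lemma transfer_factor_mult:
  assumes c: "c \<in> rcosets N" and g: "g \<in> carrier G" and h: "h \<in> carrier G"
  shows "transfer_factor G \<phi> c (g \<otimes> h) =
    transfer_factor G \<phi> c g \<otimes>\<^bsub>C\<^esub> transfer_factor G \<phi> (c #> g) h"
proof -
  let ?r = coset_rep
  note cg = rcoset_act[OF c g]
  have "?r c \<otimes> (g \<otimes> h) \<otimes> inv ?r (c #> (g \<otimes> h)) =
      (?r c \<otimes> g \<otimes> inv ?r (c #> g)) \<otimes> (?r (c #> g) \<otimes> h \<otimes> inv ?r (c #> g #> h))"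
    using coset_rep_mem(2)[OF c] coset_rep_mem(2)[OF cg] coset_rep_mem(2)[OF rcoset_act[OF cg h]] g h
    by (simp add: rcoset_act_mult[OF c g h] m_assoc inv_mult_cancel_left)
  then show ?thesis
    unfolding transfer_factor_def
    using phi_mult transfer_factor_arg_mem[OF c g] transfer_factor_arg_mem[OF cg h] by simp
qed

text \<open>On a coset fixed by \<open>g\<close> the chosen representative is irrelevant, because changing it conjugates the
argument of \<open>\<phi>\<close> inside \<open>N\<close>.\<close>

lemma transfer_factor_fixed:
  assumes t: "t \<in> carrier G" and g: "g \<in> carrier G" and N: "t \<otimes> g \<otimes> inv t \<in> N"
  shows "transfer_factor G \<phi> (N #> t) g = \<phi> (t \<otimes> g \<otimes> inv t)"
proof -
  let ?s = "coset_rep (N #> t)"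
  have c: "N #> t \<in> rcosets N" using t by (intro rcosetsI N.subset)
  note s = coset_rep_mem[OF c]
  define n where "n = ?s \<otimes> inv t"
  have n: "n \<in> N" unfolding n_def
    using rcos_eq_iff[OF subgroup_N, of ?s t] s t by simp
  have e: "?s = n \<otimes> t" using s(2) t by (simp add: n_def m_assoc)
  have "N #> t #> g = N #> t" using rcoset_act_eq_iff t g N by blast
  then have "transfer_factor G \<phi> (N #> t) g = \<phi> (?s \<otimes> g \<otimes> inv ?s)"
    by (simp add: transfer_factor_def)
  also have "?s \<otimes> g \<otimes> inv ?s = n \<otimes> (t \<otimes> g \<otimes> inv t) \<otimes> inv n"
    unfolding e using N.mem_carrier[OF n] t g by (simp add: m_assoc inv_mult_group)
  finally show ?thesis using phi_conj[OF n N] by simp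
qed

lemma rcoset_act_bij:
  assumes g: "g \<in> carrier G"
  shows "inj_on (\<lambda>c. c #> g) (rcosets N)" "(\<lambda>c. c #> g) ` (rcosets N) = rcosets N"
proof -
  show 1: "inj_on (\<lambda>c. c #> g) (rcosets N)"
  proof (rule inj_on_inverseI)
    fix c assume "c \<in> rcosets N"
    then show "c #> g #> inv g = c" using g by (simp add: rcoset_act_mult rcoset_act_one)
  qed
  show "(\<lambda>c. c #> g) ` (rcosets N) = rcosets N"
    by (rule endo_inj_surj[OF finite_rcosets _ 1]) (use rcoset_act g in auto)
qed

lemma transfer_hom: "group_transfer G N C \<phi> \<in> hom G C"
proof (rule homI)
  fix g assume g: "g \<in> carrier G"
  then show "group_transfer G N C \<phi> g \<in> carrier C"
    unfolding group_transfer_def by (intro C.finprod_closed) (auto intro: transfer_factor_closed)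
next
  fix g h assume g: "g \<in> carrier G" and h: "h \<in> carrier G"
  let ?R = "rcosets N" and ?f = "transfer_factor G \<phi>"
  have "group_transfer G N C \<phi> (g \<otimes> h) = finprod C (\<lambda>c. ?f c g \<otimes>\<^bsub>C\<^esub> ?f (c #> g) h) ?R"
    unfolding group_transfer_def
    by (rule C.finprod_cong') (use g h in \<open>auto simp: transfer_factor_mult transfer_factor_closed rcoset_act\<close>)
  also have "\<dots> = finprod C (\<lambda>c. ?f c g) ?R \<otimes>\<^bsub>C\<^esub> finprod C (\<lambda>c. ?f (c #> g) h) ?R"
    by (rule C.finprod_multf) (use g h in \<open>auto simp: transfer_factor_closed rcoset_act\<close>)
  also have "finprod C (\<lambda>c. ?f (c #> g) h) ?R = finprod C (\<lambda>c. ?f c h) ((\<lambda>c. c #> g) ` ?R)"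
    by (rule C.finprod_reindex[symmetric])
      (use rcoset_act_bij[OF g] transfer_factor_closed[OF _ h] in auto)
  finally show "group_transfer G N C \<phi> (g \<otimes> h) =
      group_transfer G N C \<phi> g \<otimes>\<^bsub>C\<^esub> group_transfer G N C \<phi> h"
    by (simp add: group_transfer_def rcoset_act_bij[OF g])
qed

lemma transfer_factor_pow:
  assumes c: "c \<in> rcosets N" and g: "g \<in> carrier G"
  shows "finprod C (\<lambda>i. transfer_factor G \<phi> (c #> g [^] i) g) {..<n} =
    transfer_factor G \<phi> c (g [^] (n :: nat))"
proof (induction n)
  case 0
  have "transfer_factor G \<phi> c \<one> = \<phi> \<one>"
    using coset_rep_mem[OF c] by (simp add: transfer_factor_def rcoset_act_one[OF c])
  then show ?case by (simp add: phi_one)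
next
  case (Suc n)
  have cl: "transfer_factor G \<phi> (c #> g [^] i) g \<in> carrier C" for i :: nat
    using c g by (intro transfer_factor_closed rcoset_act) auto
  then show ?case
    using c g Suc transfer_factor_mult[of c "g [^] n" g]
    by (simp add: lessThan_Suc Pi_def C.m_comm transfer_factor_closed)
qed

lemma funpow_rcoset_act:
  assumes "c \<in> rcosets N" "g \<in> carrier G"
  shows "((\<lambda>c. c #> g) ^^ i) c = c #> g [^] (i :: nat)"
  using assms by (induction i) (simp_all add: rcoset_act_one rcoset_act_mult)

text \<open>An orbit of \<open>x\<close> of length \<open>n > 1\<close> through \<open>Nt\<close> contributes \<open>\<phi>(t x\<^sup>n t\<^sup>-\<^sup>1)\<close>. Its length divides the order of the
\<open>p\<close>-element \<open>x\<close>, so \<open>p\<close> divides \<open>n\<close> and the contribution is trivial by assumption.\<close>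

lemma transfer_eq_fixed_product:
  assumes p: "Factorial_Ring.prime p" and x: "x \<in> carrier G" and xp: "x [^] (p ^ k) = \<one>"
    and triv: "\<And>t n. t \<in> carrier G \<Longrightarrow> p dvd n \<Longrightarrow> t \<otimes> x [^] (n :: nat) \<otimes> inv t \<in> N
      \<Longrightarrow> \<phi> (t \<otimes> x [^] n \<otimes> inv t) = \<one>\<^bsub>C\<^esub>"
  shows "group_transfer G N C \<phi> x =
    finprod C (\<lambda>c. transfer_factor G \<phi> c x) {c \<in> rcosets N. c #> x = c}"
proof -
  let ?f = "\<lambda>c. transfer_factor G \<phi> c x"
  define A where "A = {c \<in> rcosets N. c #> x = c}"
  define B where "B = {c \<in> rcosets N. c #> x \<noteq> c}"
  have fin: "finite A" "finite B" using finite_rcosets by (auto simp: A_def B_def)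
  have cl: "?f c \<in> carrier C" if "c \<in> A \<union> B" for c
    using that x by (auto simp: A_def B_def intro: transfer_factor_closed)
  have "finprod C ?f (A \<union> B) = finprod C ?f A \<otimes>\<^bsub>C\<^esub> finprod C ?f B"
    by (rule C.finprod_Un_disjoint) (use fin cl in \<open>auto simp: A_def B_def\<close>)
  moreover have "finprod C ?f B = \<one>\<^bsub>C\<^esub>"
  proof (rule C.finprod_eq_one_by_orbits[where \<sigma> = "\<lambda>c. c #> x" and m = "p ^ k"])
    fix c assume "c \<in> B"
    then have c: "c \<in> rcosets N" "c #> x \<noteq> c" by (auto simp: B_def)
    show "c #> x \<in> B"
      using c x rcoset_act_bij(1)[OF x] rcoset_act[OF c(1) x]
      by (auto simp: B_def dest: inj_onD)
    show per: "((\<lambda>c. c #> x) ^^ (p ^ k)) c = c"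
      using c x xp by (simp add: funpow_rcoset_act rcoset_act_one)
    fix n :: nat
    assume n: "0 < n" "((\<lambda>c. c #> x) ^^ n) c = c"
      and min: "\<And>i. 0 < i \<Longrightarrow> i < n \<Longrightarrow> ((\<lambda>c. c #> x) ^^ i) c \<noteq> c"
    have "((\<lambda>c. c #> x) ^^ (p ^ k mod n)) c = c"
      using funpow_mod_eq[OF n(2), of "p ^ k"] per by simp
    then have "n dvd p ^ k"
      using min[of "p ^ k mod n"] n(1) by (cases "p ^ k mod n = 0") auto
    then obtain i where i: "n = p ^ i" using divides_primepow_nat[OF p] by blast
    have "n \<noteq> 1"
    proof
      assume "n = 1"
      then have "c #> x = c" using n(2) by simp
      then show False using c(2) by (rule notE[rotated])
    qed
    then have pn: "p dvd n" using i by (cases i) auto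
    let ?t = "coset_rep c"
    note t = coset_rep_mem[OF c(1)]
    have "N #> ?t #> x [^] n = N #> ?t"
      using n(2) c x t(3) by (simp add: funpow_rcoset_act)
    then have "?t \<otimes> x [^] n \<otimes> inv ?t \<in> N"
      using rcoset_act_eq_iff[OF t(2), of "x [^] n"] x by simp
    then have "transfer_factor G \<phi> c (x [^] n) = \<one>\<^bsub>C\<^esub>"
      using transfer_factor_fixed[OF t(2), of "x [^] n"] t(3) x triv[OF t(2) pn] by simp
    then show "finprod C (\<lambda>i. ?f (((\<lambda>c. c #> x) ^^ i) c)) {..<n} = \<one>\<^bsub>C\<^esub>"
      using transfer_factor_pow[OF c(1) x, of n] c x by (simp add: funpow_rcoset_act)
  qed (use fin cl p in \<open>auto simp: prime_gt_0_nat\<close>)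
  moreover have "finprod C ?f A \<in> carrier C" using cl by (intro C.finprod_closed) auto
  moreover have "A \<union> B = rcosets N" by (auto simp: A_def B_def)
  ultimately show ?thesis
    using cl unfolding group_transfer_def A_def[symmetric] by simp
qed

end

text \<open>Lets one replace the target of the transfer by one of its quotients.\<close>

lemma group_transfer_comp:
  assumes "transfer_setting G N C \<phi>" "transfer_setting G N C' (\<theta> \<circ> \<phi>)"
    and hom: "\<theta> \<in> hom C C'" and g: "g \<in> carrier G"
  shows "group_transfer G N C' (\<theta> \<circ> \<phi>) g = \<theta> (group_transfer G N C \<phi> g)"
proof -
  interpret A: transfer_setting G N C \<phi> by fact
  interpret B: transfer_setting G N C' "\<theta> \<circ> \<phi>" by fact
  interpret h: group_hom C C' \<theta>
    using hom by (simp add: group_hom_def group_hom_axioms_def A.C.is_group B.C.is_group)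
  have "\<theta> (finprod C f A) = finprod C' (\<theta> \<circ> f) A"
    if "finite A" "f \<in> A \<rightarrow> carrier C" for A and f :: "'a set \<Rightarrow> 'c"
    using that by (induction A) (auto simp: Pi_def A.C.finprod_closed)
  from this[of "rcosets\<^bsub>G\<^esub> N" "\<lambda>c. transfer_factor G \<phi> c g"] show ?thesis
    using A.finite_rcosets A.transfer_factor_closed[OF _ g]
    by (simp add: group_transfer_def transfer_factor_def comp_def)
qed

section \<open>Evaluating the transfer at a minimal \<open>p\<close>-element\<close>

lemma (in transfer_setting) phi_nat_pow:
  "n \<in> N \<Longrightarrow> \<phi> (n [^] (m :: nat)) = \<phi> n [^]\<^bsub>C\<^esub> m"
  by (induction m) (simp_all add: phi_one phi_mult N.nat_pow_mem[OF is_group])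

text \<open>Since \<open>\<phi>\<close> has exponent \<open>p\<close>, passing from \<open>n0\<close> to its \<open>p\<close>-part does not kill its value. Minimizing over \<open>p\<close>-elements
then gives the element at which the transfer is evaluated.\<close>

lemma (in transfer_setting) exists_minimal_p_element:
  assumes p: "Factorial_Ring.prime (p :: nat)"
    and exp: "\<And>n. n \<in> N \<Longrightarrow> \<phi> n [^]\<^bsub>C\<^esub> p = \<one>\<^bsub>C\<^esub>"
    and n0: "n0 \<in> N" "\<phi> n0 \<noteq> \<one>\<^bsub>C\<^esub>"
  shows "\<exists>x k. x \<in> N \<and> x [^] (p ^ Suc k) = \<one> \<and> \<phi> x \<noteq> \<one>\<^bsub>C\<^esub> \<and>
    (\<forall>z \<in> N. z [^] (p ^ k) = \<one> \<longrightarrow> \<phi> z = \<one>\<^bsub>C\<^esub>)"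
proof -
  let ?Q = "\<lambda>k. \<exists>x \<in> N. x [^] (p ^ k) = \<one> \<and> \<phi> x \<noteq> \<one>\<^bsub>C\<^esub>"
  have "order G \<noteq> 0" using finite_carrier order_gt_0_iff_finite by simp
  then obtain a m where m: "order G = m * p ^ a" "\<not> p dvd m"
    using p finite_carrier by (metis multiplicity_decompose' mult.commute not_prime_unit)
  have "(n0 [^] m) [^] (p ^ a) = \<one>"
    using n0 pow_order_eq_1[of n0] by (simp add: nat_pow_pow m(1))
  moreover have "\<phi> (n0 [^] m) \<noteq> \<one>\<^bsub>C\<^esub>"
  proof
    assume "\<phi> (n0 [^] m) = \<one>\<^bsub>C\<^esub>"
    moreover have "coprime m p" using prime_imp_coprime[OF p m(2)] by (simp add: coprime_commute)
    ultimately have "\<phi> n0 \<in> {\<one>\<^bsub>C\<^esub>}"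
      using subgroup.mem_of_coprime_powers[OF C.triv_subgroup C.is_group, of "\<phi> n0" m p]
        exp[OF n0(1)] phi_closed[OF n0(1)] by (simp add: phi_nat_pow n0(1))
    then show False using n0(2) by simp
  qed
  ultimately have "?Q a" using n0(1) N.nat_pow_mem[OF is_group] by blast
  define j where "j = (LEAST k. ?Q k)"
  have Q: "?Q j" unfolding j_def by (rule LeastI) fact
  have min: "\<not> ?Q k" if "k < j" for k
    using that unfolding j_def by (rule not_less_Least)
  have "j \<noteq> 0"
  proof
    assume "j = 0"
    then obtain x where "x \<in> N" "x [^] (1 :: nat) = \<one>" "\<phi> x \<noteq> \<one>\<^bsub>C\<^esub>" using Q by auto
    then show False by (simp add: phi_one)
  qed
  then obtain k where k: "j = Suc k" by (cases j) auto
  from Q obtain x where "x \<in> N" "x [^] (p ^ Suc k) = \<one>" "\<phi> x \<noteq> \<one>\<^bsub>C\<^esub>"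
    unfolding k by blast
  moreover have "\<not> ?Q k" by (rule min) (simp add: k)
  ultimately show ?thesis by blast
qed

text \<open>The central computation. In the application \<open>P\<close> is a Sylow subgroup and \<open>N\<close> its normalizer, and
\<open>{a \<in> P. t \<otimes> a \<otimes> inv t \<in> P}\<close> is \<open>P \<inter> P\<^sup>t\<close>. At a minimal \<open>p\<close>-element \<open>x\<close> with \<open>\<phi>(x) \<noteq> 1\<close>, all cosets
other than \<open>N\<close> together contribute \<open>1\<close>: those moved by \<open>x\<close> by minimality, and those fixed by \<open>x\<close> because
they fall into cycles of length \<open>p\<close> under multiplication by elements \<open>y\<close> of \<open>P\<close> to which
\<open>finprod_conjugates_eq_one\<close> applies.\<close>

lemma (in transfer_setting) transfer_nontrivial:
  assumes p: "Factorial_Ring.prime (p :: nat)" and P: "subgroup P G" and card_P: "card P = p ^ e"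
    and PN: "P \<subseteq> N" and P_normal: "\<And>n a. n \<in> N \<Longrightarrow> a \<in> P \<Longrightarrow> n \<otimes> a \<otimes> inv n \<in> P"
    and p_element: "\<And>n k. n \<in> N \<Longrightarrow> n [^] (p ^ k) = \<one> \<Longrightarrow> n \<in> P"
    and inter: "\<And>t. t \<in> carrier G \<Longrightarrow> t \<notin> N \<Longrightarrow> {a \<in> P. t \<otimes> a \<otimes> inv t \<in> P} \<noteq> P \<and>
      card {a \<in> P. t \<otimes> a \<otimes> inv t \<in> P} \<le> card (upper_central (G\<lparr>carrier := P\<rparr>) (p - 1))"
    and exp: "\<And>n. n \<in> N \<Longrightarrow> \<phi> n [^]\<^bsub>C\<^esub> p = \<one>\<^bsub>C\<^esub>"
    and n0: "n0 \<in> N" "\<phi> n0 \<noteq> \<one>\<^bsub>C\<^esub>"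
  shows "\<exists>x \<in> N. group_transfer G N C \<phi> x \<noteq> \<one>\<^bsub>C\<^esub>"
proof -
  obtain x k where x: "x \<in> N" "x [^] (p ^ Suc k) = \<one>" "\<phi> x \<noteq> \<one>\<^bsub>C\<^esub>"
    and small: "\<And>z. z \<in> N \<Longrightarrow> z [^] (p ^ k) = \<one> \<Longrightarrow> \<phi> z = \<one>\<^bsub>C\<^esub>"
    using exists_minimal_p_element[OF p exp n0] by blast
  have xG: "x \<in> carrier G" using x(1) by simp
  have xP: "x \<in> P" using p_element x by blast
  interpret P: subgroup P G by fact
  let ?H = "G\<lparr>carrier := P\<rparr>"
  interpret H: group ?H by (rule subgroup_imp_group[OF P])
  let ?f = "\<lambda>c. transfer_factor G \<phi> c x"
  define D where "D t = {a \<in> P. t \<otimes> a \<otimes> inv t \<in> P}" for t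

  have D_subgroup: "subgroup (D t) G" if t: "t \<in> carrier G" for t
  proof (rule subgroupI)
    show "D t \<subseteq> carrier G" using P.subset by (auto simp: D_def)
    show "D t \<noteq> {}" using t by (auto simp: D_def intro!: exI[of _ \<one>])
  next
    fix a assume a: "a \<in> D t"
    have "inv (t \<otimes> a \<otimes> inv t) \<in> P" using a by (auto simp: D_def)
    moreover have "inv (t \<otimes> a \<otimes> inv t) = t \<otimes> inv a \<otimes> inv t"
      using t a P.mem_carrier by (simp add: D_def inv_mult_group m_assoc)
    ultimately show "inv a \<in> D t" using a by (auto simp: D_def)
  next
    fix a b assume a: "a \<in> D t" and b: "b \<in> D t"
    have "(t \<otimes> a \<otimes> inv t) \<otimes> (t \<otimes> b \<otimes> inv t) \<in> P" using a b by (auto simp: D_def)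
    moreover have "(t \<otimes> a \<otimes> inv t) \<otimes> (t \<otimes> b \<otimes> inv t) = t \<otimes> (a \<otimes> b) \<otimes> inv t"
      using t a b P.mem_carrier by (simp add: D_def inv_mult_cancel_left m_assoc)
    ultimately show "a \<otimes> b \<in> D t" using a b by (auto simp: D_def)
  qed
  have D_H: "subgroup (D t) ?H" if "t \<in> carrier G" for t
    by (rule subgroup_incl[OF D_subgroup[OF that] P]) (auto simp: D_def)

  define good where "good B y \<longleftrightarrow> y \<in> P \<and> y \<notin> B \<and> y [^] p \<in> B \<and> (\<forall>d \<in> B. y \<otimes> d \<otimes> inv y \<in> B) \<and>
    (y \<in> upper_central ?H (p - 1) \<or> B \<subseteq> upper_central ?H (p - 1))" for B y
  \<comment> \<open>The element \<open>y\<close> is chosen as a function of the subgroup \<open>D\<close> alone, so that all cosets with the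
    same \<open>D\<close> are moved by the same element.\<close>
  define Y where "Y B = (SOME y. good B y)" for B
  have Y: "good (D t) (Y (D t))" if t: "t \<in> carrier G" "t \<notin> N" for t
  proof -
    have "\<exists>y. good (D t) y"
      using H.exists_central_normalizing_element[OF _ _ D_H[OF t(1)], of p e "p - 1"]
        inter[OF t] P.subset finite_carrier card_P
      by (auto simp: good_def D_def[symmetric] order_def finite_subset m_inv_consistent[OF P]
          simp flip: nat_pow_consistent)
    then show ?thesis unfolding Y_def by (rule someI_ex)
  qed

  have D_shift: "D (t \<otimes> y) = D t"
    if t: "t \<in> carrier G" and y: "y \<in> P" and n: "\<And>d. d \<in> D t \<Longrightarrow> y \<otimes> d \<otimes> inv y \<in> D t" for t y
  proof -
    have yG: "y \<in> carrier G" using y by simp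
    have sub: "D t \<subseteq> carrier G" using P.subset by (auto simp: D_def)
    have inj: "inj_on (\<lambda>d. y \<otimes> d \<otimes> inv y) (carrier G)"
      using yG by (intro inj_onI) simp
    have "(\<lambda>d. y \<otimes> d \<otimes> inv y) ` D t = D t"
      using n sub finite_carrier inj_on_subset[OF inj sub]
      by (intro endo_inj_surj) (auto intro: finite_subset)
    then have 1: "y \<otimes> a \<otimes> inv y \<in> D t \<longleftrightarrow> a \<in> D t" if "a \<in> carrier G" for a
      using inj_on_image_mem_iff[OF inj that sub] by simp
    have "a \<in> D (t \<otimes> y) \<longleftrightarrow> a \<in> P \<and> y \<otimes> a \<otimes> inv y \<in> D t" for a
      using t y yG by (auto simp: D_def inv_mult_group m_assoc)
    moreover have "a \<in> P" if "a \<in> D t" for a using that by (simp add: D_def)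
    ultimately show ?thesis using 1 P.mem_carrier by blast
  qed

  define A where "A = {c \<in> rcosets N. c #> x = c}"
  define F where "F = A - {N}"
  have mem_F: "N #> t \<in> F \<longleftrightarrow> t \<notin> N \<and> x \<in> D t" if t: "t \<in> carrier G" for t
  proof -
    have "N #> t = N \<longleftrightarrow> t \<in> N"
      using coset_join1[OF _ t subgroup_N] coset_join2[OF t subgroup_N] by blast
    moreover have "t \<otimes> x \<otimes> inv t \<in> N \<longleftrightarrow> t \<otimes> x \<otimes> inv t \<in> P"
      using p_element[of "t \<otimes> x \<otimes> inv t" "Suc k"] PN x(2) t xG by (auto simp: conj_nat_pow simp del: power_Suc)
    ultimately show ?thesis
      using rcoset_act_eq_iff[OF t xG] t xP rcosetsI[OF N.subset t]
      by (auto simp: F_def A_def D_def)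
  qed

  \<comment> \<open>The permutation \<open>Nt \<mapsto> Nty\<close>, where \<open>y\<close> belongs to \<open>D t\<close>; it leaves \<open>D\<close> unchanged, so its
    iterates multiply by powers of the same \<open>y\<close>.\<close>
  define \<sigma> where "\<sigma> c = c #> Y (D (coset_rep c))" for c
  have D_rep: "D (coset_rep (N #> t)) = D t" if t: "t \<in> carrier G" for t
  proof -
    let ?s = "coset_rep (N #> t)"
    have c: "N #> t \<in> rcosets N" using t by (intro rcosetsI N.subset)
    note s = coset_rep_mem[OF c]
    have n: "?s \<otimes> inv t \<in> N" using rcos_eq_iff[OF subgroup_N, of ?s t] s t by simp
    have n': "inv (?s \<otimes> inv t) \<in> N" using n by simp
    have "?s \<otimes> a \<otimes> inv ?s \<in> P \<longleftrightarrow> t \<otimes> a \<otimes> inv t \<in> P" if a: "a \<in> P" for a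
      using P_normal[OF n, of "t \<otimes> a \<otimes> inv t"] P_normal[OF n', of "?s \<otimes> a \<otimes> inv ?s"]
        t s(2) P.mem_carrier[OF a]
      by (auto simp: m_assoc inv_mult_group inv_mult_cancel_left)
    then show ?thesis by (auto simp: D_def)
  qed

  have orbit: "(\<sigma> ^^ i) (N #> t) = N #> (t \<otimes> Y (D t) [^] i) \<and> D (t \<otimes> Y (D t) [^] i) = D t \<and>
      t \<otimes> Y (D t) [^] i \<notin> N"
    if t: "t \<in> carrier G" "t \<notin> N" for t and i :: nat
  proof (induction i)
    case 0
    show ?case using t by simp
  next
    case (Suc i)
    let ?y = "Y (D t)" and ?u = "t \<otimes> Y (D t) [^] i"
    have y: "?y \<in> P" "\<And>d. d \<in> D t \<Longrightarrow> ?y \<otimes> d \<otimes> inv ?y \<in> D t"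
      using Y[OF t] by (auto simp: good_def)
    have yG: "?y \<in> carrier G" using y(1) by simp
    have uG: "?u \<in> carrier G" using t yG by simp
    have e: "t \<otimes> ?y [^] Suc i = ?u \<otimes> ?y" using t yG by (simp add: m_assoc)
    have "(\<sigma> ^^ Suc i) (N #> t) = \<sigma> (N #> ?u)" using Suc by simp
    also have "\<dots> = N #> ?u #> ?y" using Suc by (simp add: \<sigma>_def D_rep[OF uG])
    finally have "(\<sigma> ^^ Suc i) (N #> t) = N #> ?u #> ?y" .
    then have 1: "(\<sigma> ^^ Suc i) (N #> t) = N #> (t \<otimes> ?y [^] Suc i)"
      unfolding e using uG yG by (simp add: coset_mult_assoc N.subset)
    have 2: "D (?u \<otimes> ?y) = D t" using D_shift[OF uG y(1)] y(2) Suc by simp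
    have "?u \<otimes> ?y \<notin> N"
    proof
      assume "?u \<otimes> ?y \<in> N"
      then have "?u \<otimes> ?y \<otimes> inv ?y \<in> N" using PN y(1) by blast
      then show False using Suc uG yG by (simp add: m_assoc)
    qed
    then show ?case using 1 2 unfolding e by simp
  qed

  have F_one: "finprod C ?f F = \<one>\<^bsub>C\<^esub>"
  proof (rule C.finprod_eq_one_by_orbits[where \<sigma> = \<sigma> and m = p])
    show "finite F" using finite_rcosets by (simp add: F_def A_def)
    show "0 < p" using p by (rule prime_gt_0_nat)
    fix c assume c: "c \<in> F"
    then have cR: "c \<in> rcosets N" by (simp add: F_def A_def)
    then show "?f c \<in> carrier C" by (rule transfer_factor_closed) (rule xG)
    define t where "t = coset_rep c"
    have tG: "t \<in> carrier G" and ct: "c = N #> t" using coset_rep_mem[OF cR] by (auto simp: t_def)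
    have tN: "t \<notin> N" and xD: "x \<in> D t" using mem_F[OF tG] c ct by auto
    define y where "y = Y (D t)"
    have y: "y \<in> P" "y \<notin> D t" "y [^] p \<in> D t" "\<And>d. d \<in> D t \<Longrightarrow> y \<otimes> d \<otimes> inv y \<in> D t"
      "y \<in> upper_central ?H (p - 1) \<or> D t \<subseteq> upper_central ?H (p - 1)"
      using Y[OF tG tN] by (auto simp: good_def y_def)
    have yG: "y \<in> carrier G" using y(1) by simp
    have si: "(\<sigma> ^^ i) c = N #> (t \<otimes> y [^] i)" for i
      using orbit[OF tG tN, of i] by (simp add: ct y_def)
    have siF: "(\<sigma> ^^ i) c \<in> F" for i
      unfolding si using orbit[OF tG tN, of i] mem_F[of "t \<otimes> y [^] i"] tG yG xD
      by (simp add: y_def)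
    show "\<sigma> c \<in> F" using siF[of 1] by simp
    have fix_iff: "(\<sigma> ^^ i) c = c \<longleftrightarrow> y [^] i \<in> D t" for i
    proof -
      have yi: "y [^] i \<in> P" using y(1) P.nat_pow_mem[OF is_group] by blast
      have "(\<sigma> ^^ i) c = c \<longleftrightarrow> t \<otimes> y [^] i \<otimes> inv t \<in> N"
        unfolding si unfolding ct using rcoset_act_eq_iff[OF tG, of "y [^] i"] tG yG
        by (simp add: coset_mult_assoc N.subset)
      also have "\<dots> \<longleftrightarrow> t \<otimes> y [^] i \<otimes> inv t \<in> P"
      proof
        assume "t \<otimes> y [^] i \<otimes> inv t \<in> N"
        moreover have "(y [^] i) [^] (p ^ e) = \<one>"
          using H.pow_order_eq_1[of "y [^] i"] yi card_P
          by (simp add: order_def flip: nat_pow_consistent)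
        ultimately show "t \<otimes> y [^] i \<otimes> inv t \<in> P"
          using p_element[of _ e] tG yG by (simp add: conj_nat_pow)
      qed (use PN in blast)
      finally show ?thesis using yi by (simp add: D_def)
    qed
    show "(\<sigma> ^^ p) c = c" using fix_iff y(3) by blast
    fix n :: nat
    assume n: "0 < n" "(\<sigma> ^^ n) c = c" and min: "\<And>i. 0 < i \<Longrightarrow> i < n \<Longrightarrow> (\<sigma> ^^ i) c \<noteq> c"
    \<comment> \<open>A cycle closes after \<open>i\<close> steps exactly when \<open>y\<^sup>i \<in> D t\<close>, and \<open>y \<notin> D t\<close> while \<open>y\<^sup>p \<in> D t\<close>.\<close>
    have "n = p"
    proof (rule ccontr)
      assume "n \<noteq> p"
      moreover have "\<not> p < n" using min[of p] fix_iff y(3) p prime_gt_0_nat by blast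
      ultimately have "n < p" by simp
      then have "coprime n p"
        using p n(1) by (metis coprime_commute nat_dvd_not_less prime_imp_coprime)
      then have "y \<in> D t"
        using subgroup.mem_of_coprime_powers[OF D_subgroup[OF tG] is_group yG] fix_iff n(2) y(3)
        by blast
      then show False using y(2) by blast
    qed
    define l where "l a = \<phi> (t \<otimes> a \<otimes> inv t)" for a
    have tD: "t \<otimes> a \<otimes> inv t \<in> N" if "a \<in> D t" for a using that PN by (auto simp: D_def)
    have l: "l \<in> hom (?H\<lparr>carrier := D t\<rparr>) C"
    proof (rule homI)
      fix a b assume "a \<in> carrier (?H\<lparr>carrier := D t\<rparr>)" "b \<in> carrier (?H\<lparr>carrier := D t\<rparr>)"
      then have a: "a \<in> D t" and b: "b \<in> D t" by auto
      have "t \<otimes> (a \<otimes> b) \<otimes> inv t = (t \<otimes> a \<otimes> inv t) \<otimes> (t \<otimes> b \<otimes> inv t)"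
        using tG a b P.mem_carrier by (simp add: D_def inv_mult_cancel_left m_assoc)
      then show "l (a \<otimes>\<^bsub>?H\<lparr>carrier := D t\<rparr>\<^esub> b) = l a \<otimes>\<^bsub>C\<^esub> l b"
        using phi_mult[OF tD[OF a] tD[OF b]] by (simp add: l_def)
    qed (use tD phi_closed in \<open>auto simp: l_def\<close>)
    have factor: "?f ((\<sigma> ^^ i) c) = l (y [^]\<^bsub>?H\<^esub> i \<otimes>\<^bsub>?H\<^esub> x \<otimes>\<^bsub>?H\<^esub> inv\<^bsub>?H\<^esub> (y [^]\<^bsub>?H\<^esub> i))" for i
    proof -
      let ?u = "t \<otimes> y [^] i"
      have uG: "?u \<in> carrier G" using tG yG by simp
      have yi: "y [^] i \<in> P" using y(1) P.nat_pow_mem[OF is_group] by blast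
      have "x \<in> D ?u" using orbit[OF tG tN, of i] xD by (simp add: y_def)
      then have uN: "?u \<otimes> x \<otimes> inv ?u \<in> N" using PN by (auto simp: D_def)
      have "?f ((\<sigma> ^^ i) c) = \<phi> (?u \<otimes> x \<otimes> inv ?u)"
        unfolding si by (rule transfer_factor_fixed[OF uG xG uN])
      also have "?u \<otimes> x \<otimes> inv ?u = t \<otimes> (y [^] i \<otimes> x \<otimes> inv (y [^] i)) \<otimes> inv t"
        using tG yG xG by (simp add: m_assoc inv_mult_group)
      finally have "?f ((\<sigma> ^^ i) c) = l (y [^] i \<otimes> x \<otimes> inv (y [^] i))"
        by (simp add: l_def)
      then show ?thesis
        using yi by (simp add: m_inv_consistent[OF P] flip: nat_pow_consistent)
    qed
    have conj_H: "y \<otimes>\<^bsub>?H\<^esub> d \<otimes>\<^bsub>?H\<^esub> inv\<^bsub>?H\<^esub> y \<in> D t" if "d \<in> D t" for d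
      using y(4)[OF that] y(1) by (simp add: m_inv_consistent[OF P])
    have "finprod C (\<lambda>i. ?f ((\<sigma> ^^ i) c)) {..<p} = \<one>\<^bsub>C\<^esub>"
      unfolding factor
      by (rule H.finprod_conjugates_eq_one[OF p comm_group_C D_H[OF tG] _ conj_H y(5) l _ xD])
        (use y(1) tD exp in \<open>auto simp: l_def\<close>)
    then show "finprod C (\<lambda>i. ?f ((\<sigma> ^^ i) c)) {..<n} = \<one>\<^bsub>C\<^esub>"
      using \<open>n = p\<close> by simp
  qed
  have trivial: "\<phi> (t \<otimes> x [^] n \<otimes> inv t) = \<one>\<^bsub>C\<^esub>"
    if t: "t \<in> carrier G" and n: "p dvd n" and N: "t \<otimes> x [^] n \<otimes> inv t \<in> N" for t and n :: nat
  proof (rule small[OF N])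
    obtain m where m: "n = p * m" using n ..
    have "(x [^] n) [^] (p ^ k) = (x [^] (p ^ Suc k)) [^] m"
      using xG by (simp add: nat_pow_pow m mult_ac)
    then show "(t \<otimes> x [^] n \<otimes> inv t) [^] (p ^ k) = \<one>"
      using t xG x(2) by (simp add: conj_nat_pow)
  qed
  have "N \<in> A"
    using rcosetsI[OF N.subset one_closed] coset_mult_one[OF N.subset] N.rcos_const[OF is_group x(1)]
    by (simp add: A_def)
  then have A: "A = insert N F" by (auto simp: F_def)
  have fN: "?f N = \<phi> x"
    using transfer_factor_fixed[of \<one> x] x(1) xG coset_mult_one[OF N.subset] by simp
  have "group_transfer G N C \<phi> x = finprod C ?f A"
    unfolding A_def by (rule transfer_eq_fixed_product[OF p xG x(2) trivial])
  also have "\<dots> = ?f N \<otimes>\<^bsub>C\<^esub> finprod C ?f F"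
    unfolding A using finite_rcosets transfer_factor_closed[OF _ xG] phi_closed[OF x(1)]
    by (intro C.finprod_insert) (auto simp: F_def A_def fN)
  also have "\<dots> = \<phi> x" using F_one fN phi_closed[OF x(1)] by simp
  finally show ?thesis using x by (intro bexI[of _ x]) auto
qed

section \<open>Small intersections of Sylow subgroups\<close>

lemma (in group) mem_normalizer_iff:
  assumes P: "subgroup P G" and fin: "finite P"
  shows "g \<in> normalizer G P \<longleftrightarrow> g \<in> carrier G \<and> (\<forall>a \<in> P. g \<otimes> a \<otimes> inv g \<in> P)"
proof -
  interpret P: subgroup P G by fact
  have e: "g <# P #> inv g = (\<lambda>a. g \<otimes> a \<otimes> inv g) ` P"
    by (auto simp: l_coset_def r_coset_def)
  have "(\<lambda>a. g \<otimes> a \<otimes> inv g) ` P = P \<longleftrightarrow> (\<forall>a \<in> P. g \<otimes> a \<otimes> inv g \<in> P)" if "g \<in> carrier G"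
  proof
    assume "\<forall>a \<in> P. g \<otimes> a \<otimes> inv g \<in> P"
    then show "(\<lambda>a. g \<otimes> a \<otimes> inv g) ` P = P"
      using that by (intro endo_inj_surj fin inj_onI) auto
  qed blast
  then show ?thesis
    using P.subset by (auto simp: normalizer_def stabilizer_def e)
qed

text \<open>Only the intersections of one fixed Sylow subgroup with the others matter, since the cosets of
\<open>N\<^sub>G(P)\<close> correspond to the conjugates of \<open>P\<close>.\<close>

locale small_sylow_intersections = group G for G (structure) +
  fixes p :: nat and P
  assumes finite_carrier: "finite (carrier G)" and prime_p: "Factorial_Ring.prime p"
    and sylow: "sylow_subgroup p P G"
    and small: "\<And>Q. sylow_subgroup p Q G \<Longrightarrow> P \<noteq> Q \<Longrightarrow>
      card (P \<inter> Q) \<le> card (upper_central (G\<lparr>carrier := P\<rparr>) (p - 1))"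
begin

abbreviation "N \<equiv> normalizer G P"
abbreviation "e \<equiv> multiplicity p (order G)"

lemma P_subgroup: "subgroup P G" and card_P: "card P = p ^ e"
  using sylow by (auto simp: sylow_subgroup_def)

lemma P_subset: "P \<subseteq> carrier G" and finite_P: "finite P"
  using subgroup.subset[OF P_subgroup] finite_carrier by (auto intro: finite_subset)

lemma mem_N_iff: "g \<in> N \<longleftrightarrow> g \<in> carrier G \<and> (\<forall>a \<in> P. g \<otimes> a \<otimes> inv g \<in> P)"
  by (rule mem_normalizer_iff[OF P_subgroup finite_P])

lemma N_subgroup: "subgroup N G"
  by (rule normalizer_imp_subgroup[OF P_subset])

lemma P_subset_N: "P \<subseteq> N"
  using P_subset subgroup.m_closed[OF P_subgroup] subgroup.m_inv_closed[OF P_subgroup]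
  by (auto simp: mem_N_iff)

lemma P_normal_in_N: "P \<lhd> G\<lparr>carrier := N\<rparr>"
  by (rule subgroup_in_normalizer[OF P_subgroup])

lemma coprime_of_mult_card_N:
  assumes "m * c = order G" "p ^ e dvd c"
  shows "coprime m p"
proof (rule ccontr)
  assume "\<not> coprime m p"
  then have "p dvd m" using prime_imp_coprime[OF prime_p] by (auto simp: coprime_commute)
  then have "p * p ^ e dvd m * c" using assms(2) by (rule mult_dvd_mono)
  then have "p ^ Suc e dvd order G" unfolding assms(1) by simp
  moreover have "order G \<noteq> 0" using finite_carrier order_gt_0_iff_finite by simp
  moreover have "\<not> is_unit p" using prime_p not_prime_unit by blast
  ultimately have "Suc e \<le> e" using power_dvd_iff_le_multiplicity by blast
  then show False by simp
qed

lemma card_P_dvd_card_N: "p ^ e dvd card N"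
proof -
  interpret N: group "G\<lparr>carrier := N\<rparr>" by (rule subgroup_imp_group[OF N_subgroup])
  have "card N = card (rcosets\<^bsub>G\<lparr>carrier := N\<rparr>\<^esub> P) * p ^ e"
    using N.lagrange[OF normal_imp_subgroup[OF P_normal_in_N]] card_P by (simp add: order_def)
  then show ?thesis by simp
qed

lemma index_N_coprime: "coprime (card (rcosets N)) p"
  by (rule coprime_of_mult_card_N[OF lagrange[OF N_subgroup] card_P_dvd_card_N])

text \<open>The quotient \<open>N / P\<close> has order coprime to \<open>p\<close>, so a \<open>p\<close>-element of \<open>N\<close> has coprime powers in \<open>P\<close>.\<close>

lemma p_element_of_N_in_P:
  assumes n: "n \<in> N" and nk: "n [^] (p ^ k) = \<one>"
  shows "n \<in> P"
proof -
  let ?H = "G\<lparr>carrier := N\<rparr>"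
  let ?m = "order (?H Mod P)"
  interpret H: group ?H by (rule subgroup_imp_group[OF N_subgroup])
  interpret P: normal P ?H by (rule P_normal_in_N)
  interpret Q: group "?H Mod P" by (rule P.factorgroup_is_group)
  interpret h: group_hom ?H "?H Mod P" "\<lambda>x. P #>\<^bsub>?H\<^esub> x"
    by (intro group_hom.intro group_hom_axioms.intro P.r_coset_hom_Mod H.is_group Q.is_group)
  have nG: "n \<in> carrier G" using n by (simp add: mem_N_iff)
  have 1: "card N = ?m * p ^ e"
    using H.lagrange[OF P.subgroup_axioms] card_P by (simp add: order_def FactGroup_def)
  have "(card (rcosets N) * ?m) * p ^ e = order G"
    using lagrange[OF N_subgroup] by (simp add: 1 mult.assoc)
  then have "coprime (card (rcosets N) * ?m) p" by (rule coprime_of_mult_card_N) simp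
  then have cop: "coprime ?m (p ^ k)" by simp
  have "P #>\<^bsub>?H\<^esub> (n [^]\<^bsub>?H\<^esub> ?m) = P"
    using h.hom_nat_pow[of n ?m] Q.pow_order_eq_1[of "P #>\<^bsub>?H\<^esub> n"] h.hom_closed[of n] n by simp
  then have "n [^]\<^bsub>?H\<^esub> ?m \<in> P"
    by (rule H.coset_join1[OF _ _ P.subgroup_axioms]) (rule H.nat_pow_closed, use n in simp)
  then have "n [^] ?m \<in> P" by (simp flip: nat_pow_consistent)
  then show ?thesis
    using subgroup.mem_of_coprime_powers[OF P_subgroup is_group nG cop] nk
      subgroup.one_closed[OF P_subgroup] by simp
qed

text \<open>The set in question is the intersection of \<open>P\<close> with the Sylow subgroup \<open>t\<^sup>-\<^sup>1 P t\<close>, which is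
different from \<open>P\<close> for \<open>t\<close> outside \<open>N\<close>.\<close>

lemma small_conjugate_intersection:
  assumes t: "t \<in> carrier G" "t \<notin> N"
  shows "{a \<in> P. t \<otimes> a \<otimes> inv t \<in> P} \<noteq> P \<and>
    card {a \<in> P. t \<otimes> a \<otimes> inv t \<in> P} \<le> card (upper_central (G\<lparr>carrier := P\<rparr>) (p - 1))"
proof -
  interpret P: subgroup P G by (rule P_subgroup)
  define Q where "Q = (\<lambda>a. inv t \<otimes> a \<otimes> t) ` P"
  have "card Q = card P" unfolding Q_def
    using t by (intro card_image inj_onI) simp
  moreover have "subgroup Q G"
  proof (rule subgroupI)
    show "Q \<subseteq> carrier G" using t by (auto simp: Q_def)
    show "Q \<noteq> {}" unfolding Q_def using P.one_closed by blast
  next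
    fix a assume "a \<in> Q"
    then obtain b where b: "b \<in> P" "a = inv t \<otimes> b \<otimes> t" by (auto simp: Q_def)
    then have "inv a = inv t \<otimes> inv b \<otimes> t" using t by (simp add: inv_mult_group m_assoc)
    then show "inv a \<in> Q" using b by (auto simp: Q_def)
  next
    fix a a' assume "a \<in> Q" "a' \<in> Q"
    then obtain b b' where b: "b \<in> P" "a = inv t \<otimes> b \<otimes> t" "b' \<in> P" "a' = inv t \<otimes> b' \<otimes> t"
      by (auto simp: Q_def)
    then have "a \<otimes> a' = inv t \<otimes> (b \<otimes> b') \<otimes> t"
      using t by (simp add: m_assoc mult_inv_cancel_left)
    then show "a \<otimes> a' \<in> Q" using b by (auto simp: Q_def)
  qed
  ultimately have "sylow_subgroup p Q G" by (simp add: sylow_subgroup_def card_P)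
  moreover have PQ: "P \<inter> Q = {a \<in> P. t \<otimes> a \<otimes> inv t \<in> P}"
  proof -
    have "a \<in> Q \<longleftrightarrow> t \<otimes> a \<otimes> inv t \<in> P" if a: "a \<in> P" for a
    proof
      assume "a \<in> Q"
      then show "t \<otimes> a \<otimes> inv t \<in> P"
        using t by (auto simp: Q_def m_assoc mult_inv_cancel_left)
    next
      assume "t \<otimes> a \<otimes> inv t \<in> P"
      moreover have "a = inv t \<otimes> (t \<otimes> a \<otimes> inv t) \<otimes> t"
        using t a by (simp add: m_assoc inv_mult_cancel_left)
      ultimately show "a \<in> Q" unfolding Q_def by blast
    qed
    then show ?thesis by blast
  qed
  moreover have ne: "{a \<in> P. t \<otimes> a \<otimes> inv t \<in> P} \<noteq> P" using t by (auto simp: mem_N_iff)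
  ultimately show ?thesis using small[of Q] by auto
qed

lemma exponent_p_transfer_nontrivial:
  assumes "transfer_setting G N C \<phi>"
    and "\<And>n. n \<in> N \<Longrightarrow> \<phi> n [^]\<^bsub>C\<^esub> p = \<one>\<^bsub>C\<^esub>"
    and "n \<in> N" "\<phi> n \<noteq> \<one>\<^bsub>C\<^esub>"
  shows "\<exists>x \<in> N. group_transfer G N C \<phi> x \<noteq> \<one>\<^bsub>C\<^esub>"
proof (rule transfer_setting.transfer_nontrivial[OF assms(1) prime_p P_subgroup card_P P_subset_N
      _ p_element_of_N_in_P small_conjugate_intersection assms(2-4)])
qed (auto simp: mem_N_iff)

text \<open>Let \<open>H\<close> be the image of the transfer, and \<open>j\<close> the least exponent with \<open>q [^] (p ^ j) \<in> H\<close> for all \<open>q\<close>.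
If \<open>H\<close> is proper, then \<open>j > 0\<close>, and \<open>q \<mapsto> H q\<^sup>r\<close> with \<open>r = p ^ (j - 1)\<close> is a nontrivial homomorphism on
\<open>C\<close> with values of order dividing \<open>p\<close>. It kills \<open>H\<close>, so after composing with it the transfer
becomes trivial, contrary to the exponent \<open>p\<close> case.\<close>

lemma p_group_transfer_surjective:
  assumes T: "transfer_setting G N C \<phi>" and surj: "\<phi> ` N = carrier C" and ord: "order C = p ^ a"
  shows "group_transfer G N C \<phi> ` carrier G = carrier C"
proof (rule ccontr)
  assume ne: "group_transfer G N C \<phi> ` carrier G \<noteq> carrier C"
  interpret T: transfer_setting G N C \<phi> by fact
  let ?V = "group_transfer G N C \<phi>"
  interpret V: group_hom G C ?V
    using T.transfer_hom by (simp add: group_hom_def group_hom_axioms_def is_group T.C.is_group)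
  define H where "H = ?V ` carrier G"
  have H: "subgroup H C" unfolding H_def by (rule V.img_is_subgroup)
  interpret H: subgroup H C by (rule H)
  define j where "j = (LEAST k. \<forall>q \<in> carrier C. q [^]\<^bsub>C\<^esub> (p ^ k) \<in> H)"
  have j: "q [^]\<^bsub>C\<^esub> (p ^ j) \<in> H" if "q \<in> carrier C" for q
  proof -
    have "\<forall>q \<in> carrier C. q [^]\<^bsub>C\<^esub> (p ^ a) \<in> H"
      using T.C.pow_order_eq_1 ord by simp
    then have "\<forall>q \<in> carrier C. q [^]\<^bsub>C\<^esub> (p ^ j) \<in> H" unfolding j_def by (rule LeastI)
    then show ?thesis using that by blast
  qed
  have "j \<noteq> 0"
  proof
    assume "j = 0"
    then have "carrier C \<subseteq> H" using j by auto
    then show False using ne H.subset by (auto simp: H_def)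
  qed
  then obtain i where i: "j = Suc i" by (cases j) auto
  have "\<not> (\<forall>q \<in> carrier C. q [^]\<^bsub>C\<^esub> (p ^ i) \<in> H)"
    by (rule not_less_Least) (simp add: i flip: j_def)
  then obtain n0 where n0: "n0 \<in> N" "\<phi> n0 [^]\<^bsub>C\<^esub> (p ^ i) \<notin> H"
    unfolding surj[symmetric] by blast
  let ?C = "C Mod H"
  interpret C': comm_group ?C by (rule T.C.abelian_FactGroup[OF H])
  have HN: "H \<lhd> C" using H by (simp add: T.C.normal_iff_subgroup)
  interpret HN: normal H C by (rule HN)
  define \<theta> where "\<theta> q = H #>\<^bsub>C\<^esub> (q [^]\<^bsub>C\<^esub> (p ^ i))" for q
  have \<theta>: "\<theta> \<in> hom C ?C"
    using HN.r_coset_hom_Mod by (auto simp: hom_def Pi_def \<theta>_def T.C.nat_pow_distrib)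
  interpret \<theta>: group_hom C ?C \<theta>
    using \<theta> by (simp add: group_hom_def group_hom_axioms_def T.C.is_group C'.is_group)
  have \<theta>_one: "\<theta> q = \<one>\<^bsub>?C\<^esub> \<longleftrightarrow> q [^]\<^bsub>C\<^esub> (p ^ i) \<in> H" if "q \<in> carrier C" for q
    using T.C.coset_join1[OF _ _ H, of "q [^]\<^bsub>C\<^esub> (p ^ i)"] T.C.coset_join2[OF _ H] that
    by (auto simp: \<theta>_def)
  have phi_hom': "\<theta> \<circ> \<phi> \<in> hom (G\<lparr>carrier := N\<rparr>) ?C"
    by (rule Group.hom_compose[OF T.phi_hom \<theta>])
  have T': "transfer_setting G N ?C (\<theta> \<circ> \<phi>)"
    by (intro transfer_setting.intro transfer_setting_axioms.intro is_group finite_carrier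
        N_subgroup C'.comm_group_axioms phi_hom')
  have exp: "(\<theta> \<circ> \<phi>) n [^]\<^bsub>?C\<^esub> p = \<one>\<^bsub>?C\<^esub>" if n: "n \<in> N" for n
  proof -
    have q: "\<phi> n \<in> carrier C" using n by (rule T.phi_closed)
    have "\<theta> (\<phi> n) [^]\<^bsub>?C\<^esub> p = \<theta> (\<phi> n [^]\<^bsub>C\<^esub> p)" using q by (simp add: \<theta>.hom_nat_pow)
    also have "\<dots> = \<one>\<^bsub>?C\<^esub>"
      using j[OF q] q by (simp add: \<theta>_one T.C.nat_pow_pow i del: one_FactGroup)
    finally show ?thesis by simp
  qed
  have "(\<theta> \<circ> \<phi>) n0 \<noteq> \<one>\<^bsub>?C\<^esub>"
    using n0 T.phi_closed by (simp add: \<theta>_one del: one_FactGroup)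
  then obtain x where x: "x \<in> N" "group_transfer G N ?C (\<theta> \<circ> \<phi>) x \<noteq> \<one>\<^bsub>?C\<^esub>"
    using exponent_p_transfer_nontrivial[OF T' exp n0(1)] by blast
  have xG: "x \<in> carrier G" using x(1) by (simp add: mem_N_iff)
  have "?V x [^]\<^bsub>C\<^esub> (p ^ i) \<in> H"
    by (rule H.nat_pow_mem[OF T.C.is_group]) (use xG in \<open>simp add: H_def\<close>)
  then have "\<theta> (?V x) = \<one>\<^bsub>?C\<^esub>" using xG by (simp add: \<theta>_one del: one_FactGroup)
  then show False
    using group_transfer_comp[OF T T' \<theta> xG] x(2) by simp
qed

text \<open>Let \<open>K\<close> be the kernel of the surjective transfer to \<open>N / A\<^sup>p(N)\<close> and \<open>B = A\<^sup>p(G) \<subseteq> K\<close>. The chain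
\<open>|G / B| \<le> |N / (N \<inter> B)| \<le> |N / A\<^sup>p(N)| = |G / K|\<close> gives \<open>B = K\<close>, and \<open>G / K\<close> is isomorphic to
\<open>N / A\<^sup>p(N)\<close>.\<close>

theorem normalizer_controls_p_transfer: "controls_p_transfer p N G"
proof -
  let ?H = "G\<lparr>carrier := N\<rparr>"
  interpret H: group ?H by (rule subgroup_imp_group[OF N_subgroup])
  interpret N: subgroup N G by (rule N_subgroup)
  have fin_N: "finite N" using N.subset finite_carrier by (rule finite_subset)

  define A where "A = Ap p ?H"
  define C where "C = ?H Mod A"
  note Ap_H = H.Ap_least[OF _ prime_p, folded A_def]
  interpret A: normal A ?H using Ap_H(1) fin_N by simp
  interpret C: comm_group C using Ap_H(2) fin_N by (simp add: C_def)
  obtain a where ord_C: "order C = p ^ a" using Ap_H(3) fin_N by (auto simp: p_group_def C_def)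
  have card_N: "card N = p ^ a * card A"
    using H.lagrange[OF A.subgroup_axioms] ord_C by (simp add: C_def order_def FactGroup_def)
  define \<phi> where "\<phi> n = A #>\<^bsub>?H\<^esub> n" for n
  have phi: "\<phi> \<in> hom ?H C"
    using A.r_coset_hom_Mod unfolding C_def \<phi>_def[abs_def] .
  have phi_surj: "\<phi> ` N = carrier C"
    by (auto simp: C_def \<phi>_def carrier_FactGroup)
  have T: "transfer_setting G N C \<phi>"
    by (intro transfer_setting.intro transfer_setting_axioms.intro is_group finite_carrier
        N_subgroup C.comm_group_axioms phi)
  let ?V = "group_transfer G N C \<phi>"
  have surj: "?V ` carrier G = carrier C"
    by (rule p_group_transfer_surjective[OF T phi_surj ord_C])
  interpret V: group_hom G C ?V
    by (intro group_hom.intro group_hom_axioms.intro transfer_setting.transfer_hom[OF T]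
        is_group C.is_group)

  let ?K = "kernel G C ?V"
  interpret K: normal ?K G by (rule V.normal_kernel)
  have iso: "G Mod ?K \<cong> C" by (rule V.FactGroup_iso[OF surj])
  have ord_K: "order (G Mod ?K) = p ^ a"
    using iso_same_card[OF iso] ord_C by (simp add: order_def)
  have "comm_group (G Mod ?K)"
    unfolding comm_FactGroup_iff[OF K.normal_axioms]
  proof (intro ballI)
    fix x y assume x: "x \<in> carrier G" and y: "y \<in> carrier G"
    define u v where "u = ?V x" and "v = ?V y"
    have uv: "u \<in> carrier C" "v \<in> carrier C" unfolding u_def v_def using x y by auto
    have "?V (x \<otimes> y \<otimes> inv (y \<otimes> x)) = u \<otimes>\<^bsub>C\<^esub> v \<otimes>\<^bsub>C\<^esub> inv\<^bsub>C\<^esub> (v \<otimes>\<^bsub>C\<^esub> u)"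
      using x y unfolding u_def v_def by (simp del: inv_mult_group)
    then have "?V (x \<otimes> y \<otimes> inv (y \<otimes> x)) = \<one>\<^bsub>C\<^esub>"
      unfolding C.m_comm[OF uv(2,1)] using uv by simp
    moreover have "x \<otimes> y \<otimes> inv (y \<otimes> x) \<in> carrier G" using x y by simp
    ultimately show "x \<otimes> y \<otimes> inv (y \<otimes> x) \<in> ?K" unfolding kernel_def by blast
  qed
  moreover have "p_group p (G Mod ?K)"
    using K.factorgroup_is_group ord_K by (auto simp: p_group_def)
  ultimately have BK: "Ap p G \<subseteq> ?K"
    by (intro Ap_least(4)[OF finite_carrier prime_p] K.normal_axioms)

  define B where "B = Ap p G"
  note Ap_G = Ap_least[OF finite_carrier prime_p, folded B_def]
  interpret B: normal B G by (rule Ap_G(1))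
  interpret Q: comm_group "G Mod B" by (rule Ap_G(2))
  obtain b where ord_Q: "order (G Mod B) = p ^ b" using Ap_G(3) by (auto simp: p_group_def)
  define M where "M = N \<inter> B"
  have M_normal: "M \<lhd> ?H"
    unfolding M_def
  proof (rule H.normal_invI)
    show "subgroup (N \<inter> B) ?H"
      by (rule subgroup_incl[OF subgroups_Inter_pair[OF N_subgroup B.subgroup_axioms] N_subgroup]) blast
    fix x h assume "x \<in> carrier ?H" "h \<in> N \<inter> B"
    then show "x \<otimes>\<^bsub>?H\<^esub> h \<otimes>\<^bsub>?H\<^esub> inv\<^bsub>?H\<^esub> x \<in> N \<inter> B"
      using B.inv_op_closed2[of x h] N.mem_carrier by (simp add: m_inv_consistent[OF N_subgroup])
  qed
  interpret M: normal M ?H by (rule M_normal)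
  have "comm_group (?H Mod M)"
    unfolding H.comm_FactGroup_iff[OF M_normal]
  proof (intro ballI)
    fix x y assume "x \<in> carrier ?H" "y \<in> carrier ?H"
    then have x: "x \<in> N" and y: "y \<in> N" by auto
    have "x \<otimes> y \<otimes> inv (y \<otimes> x) \<in> B"
      using Ap_G(2) comm_FactGroup_iff[OF B.normal_axioms] x y by auto
    then show "x \<otimes>\<^bsub>?H\<^esub> y \<otimes>\<^bsub>?H\<^esub> inv\<^bsub>?H\<^esub> (y \<otimes>\<^bsub>?H\<^esub> x) \<in> M"
      using x y by (simp add: M_def m_inv_consistent[OF N_subgroup])
  qed
  moreover have dvd: "order (?H Mod M) dvd p ^ b"
  proof -
    interpret f: group_hom ?H "G Mod B" "\<lambda>n. B #> n"
      using B.r_coset_hom_Mod N.mem_carrier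
      by (intro group_hom.intro group_hom_axioms.intro H.is_group Q.is_group) (auto simp: hom_def Pi_def)
    let ?I = "(\<lambda>n. B #> n) ` N"
    have I: "subgroup ?I (G Mod B)" using f.img_is_subgroup by simp
    let ?E = "(G Mod B)\<lparr>carrier := ?I\<rparr>"
    interpret E: group ?E by (rule Q.subgroup_imp_group[OF I])
    interpret g: group_hom ?H ?E "\<lambda>n. B #> n"
      using f.homh by (intro group_hom.intro group_hom_axioms.intro H.is_group E.is_group)
        (auto simp: hom_def)
    have "B #> n = B \<longleftrightarrow> n \<in> B" if "n \<in> N" for n
      using coset_join1[OF _ _ B.subgroup_axioms] coset_join2[OF _ B.subgroup_axioms]
        N.mem_carrier[OF that] by blast
    then have "kernel ?H ?E (\<lambda>n. B #> n) = M" by (auto simp: kernel_def M_def)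
    then have "?H Mod M \<cong> ?E" using g.FactGroup_iso by simp
    from iso_same_card[OF this] have "order (?H Mod M) = card ?I" by (simp add: order_def)
    also have "\<dots> dvd order (G Mod B)" using Q.lagrange[OF I] by (metis dvd_triv_right)
    finally show ?thesis by (simp add: ord_Q)
  qed
  then have "\<exists>k. order (?H Mod M) = p ^ k" using divides_primepow_nat[OF prime_p] by auto
  then have "p_group p (?H Mod M)" using M.factorgroup_is_group by (simp add: p_group_def)
  ultimately have AM: "A \<subseteq> M" using Ap_H(4)[OF _ M_normal] fin_N by simp

  have finM: "finite M" using fin_N by (simp add: M_def)
  have card_NM: "order (?H Mod M) * card M = card N"
    using H.lagrange[OF M.subgroup_axioms] by (simp add: order_def FactGroup_def)
  have M_pos: "card M > 0" using finM M.one_closed card_gt_0_iff by blast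
  have A_le: "card A \<le> card M" using AM finM by (rule card_mono[rotated])
  \<comment> \<open>Since \<open>A\<close> is contained in \<open>M\<close>, the quotient by \<open>M\<close> is the smaller one.\<close>
  have "order (?H Mod M) \<le> p ^ a"
  proof (rule ccontr)
    assume "\<not> ?thesis"
    then have "p ^ a * card M < order (?H Mod M) * card M" using M_pos by simp
    moreover have "p ^ a * card A \<le> p ^ a * card M" using A_le by (rule mult_le_mono2)
    ultimately show False using card_NM card_N by linarith
  qed
  \<comment> \<open>The \<open>p\<close>-power \<open>|G / B|\<close> divides the product of \<open>|N / M|\<close> and the index of \<open>N\<close>, and
    this index is coprime to \<open>p\<close>.\<close>
  moreover have "p ^ b \<le> order (?H Mod M)"
  proof (rule dvd_imp_le)
    interpret BG: group "G\<lparr>carrier := B\<rparr>" by (rule subgroup_imp_group[OF B.subgroup_axioms])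
    have M_B: "subgroup M (G\<lparr>carrier := B\<rparr>)" unfolding M_def
      by (rule subgroup_incl[OF subgroups_Inter_pair[OF N_subgroup B.subgroup_axioms] B.subgroup_axioms])
        blast
    define c where "c = card (rcosets\<^bsub>G\<lparr>carrier := B\<rparr>\<^esub> M)"
    have c: "card B = c * card M" using BG.lagrange[OF M_B] by (simp add: c_def order_def)
    have "p ^ b * card B = order G"
      using lagrange[OF B.subgroup_axioms] ord_Q by (simp add: order_def FactGroup_def)
    also have "\<dots> = card (rcosets N) * (order (?H Mod M) * card M)"
      using lagrange[OF N_subgroup] by (simp add: card_NM)
    finally have "(p ^ b * c) * card M = (card (rcosets N) * order (?H Mod M)) * card M"
      by (simp add: c mult.assoc)
    then have "p ^ b * c = card (rcosets N) * order (?H Mod M)"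
      using M_pos unfolding mult_cancel2 by simp
    then have "p ^ b dvd card (rcosets N) * order (?H Mod M)" by (rule dvdI[OF sym])
    moreover have "coprime (p ^ b) (card (rcosets N))"
      using index_N_coprime by (simp add: coprime_commute)
    ultimately show "p ^ b dvd order (?H Mod M)" by (simp add: coprime_dvd_mult_right_iff)
    show "0 < order (?H Mod M)" using dvd prime_gt_0_nat[OF prime_p] by (auto intro: gr0I)
  qed
  ultimately have ba: "p ^ b \<le> p ^ a" by (rule order_trans[rotated])
  have "p ^ b * card B = p ^ a * card ?K"
    using lagrange[OF B.subgroup_axioms] lagrange[OF K.subgroup_axioms] ord_Q ord_K
    by (simp add: order_def FactGroup_def)
  moreover have "p ^ b * card B \<le> p ^ a * card B" using ba by (rule mult_le_mono1)
  ultimately have "p ^ a * card ?K \<le> p ^ a * card B" by simp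
  then have "card ?K \<le> card B" using prime_gt_0_nat[OF prime_p] by simp
  moreover have "finite ?K" using K.subset finite_carrier by (rule finite_subset)
  ultimately have "B = ?K" using BK unfolding B_def by (intro card_seteq)
  then have "G Mod Ap p G \<cong> ?H Mod Ap p ?H" using iso by (simp add: B_def A_def C_def)
  then have "?H Mod Ap p ?H \<cong> G Mod Ap p G"
    by (rule group.iso_sym[OF B.factorgroup_is_group, unfolded B_def])
  then show ?thesis
    using N_subgroup index_N_coprime by (simp add: controls_p_transfer_def)
qed

end

theorem corollary1p5:
  fixes G :: "('a, 'b) monoid_scheme" and p :: nat
  assumes "group G" and "finite (carrier G)"
    and "Factorial_Ring.prime p" and "p dvd order G"
    and "\<And>P Q. sylow_subgroup p P G \<Longrightarrow> sylow_subgroup p Q G \<Longrightarrow> P \<noteq> Q \<Longrightarrow>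
           card (P \<inter> Q) \<le> card (upper_central (G\<lparr>carrier := P\<rparr>) (p - 1))"
    and "sylow_subgroup p P G"
  shows "controls_p_transfer p (normalizer G P) G"
proof -
  interpret small_sylow_intersections G p P
    by (intro small_sylow_intersections.intro small_sylow_intersections_axioms.intro assms)
  show ?thesis by (rule normalizer_controls_p_transfer)
qed

end
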